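(* Let $d\ge 2$ and let $\phi:\mathbb{R}^d\to\mathbb{R}$ be infinitely differentiable with $\phi(0)=0$. There exists a random vector $\xi$ with values in $\mathbb{R}^d$, defined on some sufficiently rich probability space, such that $$\mathbf{E}e^{(\lambda,\xi)}=e^{\phi(\lambda)}\qquad\text{for all }\lambda\in\mathbb{R}^d,$$ if and only if $\exp\phi$ has a representation $$\exp\phi(\lambda)=\sum_{\epsilon\in\Theta}F_\epsilon(\lambda),\qquad\lambda\in\mathbb{R}^d,$$ where for each $\epsilon\in\Theta$ the function $F_\epsilon$ belongs to $K(\epsilon)$ (is monotonic relative to the octant $Z(\epsilon)$), and $\sum_{\epsilon\in\Theta}F_\epsilon(0)=1$.
   Context: $\Theta=\{-1,+1\}^d$; for $\epsilon\in\Theta$ the octant is $Z(\epsilon)=\{x\in\mathbb{R}^d:\ \epsilon(j)x(j)\ge 0\text{ for all }j\}$. $(\cdot,\cdot)$ is the standard scalar product on $\mathbb{R}^d$. For a multi-index $k=(k(1),\dots,k(d))$ of non-negative integers write $\epsilon^{k}=\prod_{j}\epsilon(j)^{k(j)}$, $|k|=\sum_j k(j)$ and $\partial^{k}F=\partial^{|k|}F/\partial\lambda(1)^{k(1)}\cdots\partial\lambda(d)^{k(d)}$. A (numerical, infinitely differentiable) function $F=F(\lambda)$, $\lambda\in\mathbb{R}^d$, belongs to the class $K(\epsilon)$, in other words is monotonic relative to the octant $Z(\epsilon)$, if and only if $\operatorname{sign}\,\partial^{k}F(\lambda)=\epsilon^{k}$ for all $\lambda\in\mathbb{R}^d$ and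 all multi-indices $k$.
   Formalization: The sign condition in K(ε) is read weakly (each ∂^k F(λ) is 0 or has sign ε^k), since with strict signs φ = 0 is a counterexample; the sample space of ξ is taken to be R^d, which loses nothing by passing to the law of ξ. *)

theory Defs
  imports "HOL-Probability.Probability"
begin

definition partial :: "'n::finite \<Rightarrow> (real^'n \<Rightarrow> real) \<Rightarrow> real^'n \<Rightarrow> real" where
  "partial j F x = deriv (\<lambda>t. F (x + t *\<^sub>R axis j 1)) 0"

text \<open>The function \<open>deriv\<close> is total, so \<open>partial\<close> is meaningful only where the derivative
  exists.  Infinite differentiability is therefore the demand that every iterated partial
  derivative, in every order of differentiation, is (Frechet) differentiable everywhere; this
  also makes all of them continuous.\<close>

definition smooth :: "(real^'n::finite \<Rightarrow> real) \<Rightarrow> bool" where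
  "smooth F \<longleftrightarrow> (\<forall>js x. foldr partial js F differentiable (at x))"

text \<open>The index type carries no order, so an arbitrary enumeration of the coordinates is fixed.
  The choice is immaterial for smooth functions, whose partial derivatives commute.\<close>

definition coords :: "'n::finite list" where
  "coords = (SOME js. distinct js \<and> set js = UNIV)"

definition multi_partial :: "('n::finite \<Rightarrow> nat) \<Rightarrow> (real^'n \<Rightarrow> real) \<Rightarrow> real^'n \<Rightarrow> real" where
  "multi_partial k F = foldr (\<lambda>j G. (partial j ^^ k j) G) coords F"

definition signs :: "(real^'n::finite) set" where
  "signs = {\<epsilon>. \<forall>j. \<epsilon> $ j = -1 \<or> \<epsilon> $ j = 1}"

lemma finite_signs: "finite (signs :: (real^'n::finite) set)"
proof -
  have "(signs :: (real^'n) set) \<subseteq> (\<lambda>f. \<chi> j. f j) ` (UNIV \<rightarrow> {-1,1})"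
  proof
    fix e :: "real^'n" assume "e \<in> signs"
    then show "e \<in> (\<lambda>f. \<chi> j. f j) ` (UNIV \<rightarrow> {-1,1})"
      by (intro image_eqI[of _ _ "\<lambda>j. e $ j"]) (auto simp: signs_def)
  qed
  moreover have "finite (UNIV \<rightarrow> {-1,1::real} :: ('n \<Rightarrow> real) set)"
    using finite_PiE[of "UNIV::'n set" "\<lambda>_. {-1,1::real}"] by (simp add: PiE_UNIV_domain)
  ultimately show ?thesis by (meson finite_imageI finite_subset)
qed

definition multi_power :: "real^'n::finite \<Rightarrow> ('n \<Rightarrow> nat) \<Rightarrow> real" where
  "multi_power \<epsilon> k = (\<Prod>j\<in>UNIV. (\<epsilon> $ j) ^ k j)"

text \<open>The class of functions monotonic relative to the octant of \<open>\<epsilon>\<close>.  The condition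
  \<open>sign \<partial>\<^sup>k F = \<epsilon>\<^sup>k\<close> is read in the weak sense usual for completely monotonic functions:
  the value 0 is compatible with both signs.  With strict signs the constant function 1, which
  is the exponential moment function of the zero vector, would have no decomposition: for
  \<open>k = 2 e\<^sub>j\<close> all the signs \<open>\<epsilon>\<^sup>k\<close> equal 1, but the sum of the
  derivatives \<open>\<partial>\<^sup>k F\<^sub>\<epsilon>\<close> is 0.\<close>

definition octant_monotonic :: "real^'n::finite \<Rightarrow> (real^'n \<Rightarrow> real) set" where
  "octant_monotonic \<epsilon> =
    {F. smooth F \<and> (\<forall>k x. sgn (multi_partial k F x) \<in> {0, multi_power \<epsilon> k})}"

text \<open>Integrability is stated because the Bochner integral of a non-integrable function is 0.\<close>

definition has_exp_moments :: "'w measure \<Rightarrow> ('w \<Rightarrow> real^'n::finite) \<Rightarrow> (real^'n \<Rightarrow> real) \<Rightarrow> bool" where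
  "has_exp_moments M \<xi> f \<longleftrightarrow> prob_space M \<and> \<xi> \<in> borel_measurable M \<and>
    (\<forall>l. integrable M (\<lambda>\<omega>. exp (l \<bullet> \<xi> \<omega>)) \<and>
         integral\<^sup>L M (\<lambda>\<omega>. exp (l \<bullet> \<xi> \<omega>)) = f l)"

text \<open>HOL cannot quantify existentially over the type of the sample space.  Nothing is lost by
  taking \<open>real^'n\<close> itself as sample space:\<close>

lemma has_exp_moments_canonical:
  fixes \<xi> :: "'w \<Rightarrow> real^'n::finite"
  assumes "has_exp_moments M \<xi> f"
  shows "has_exp_moments (distr M borel \<xi>) (\<lambda>x. x) f"
proof -
  have m [measurable]: "\<xi> \<in> borel_measurable M" and p: "prob_space M"
    using assms by (auto simp: has_exp_moments_def)
  have e: "(\<lambda>x. exp (l \<bullet> x)) \<in> borel_measurable borel" for l :: "real^'n"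
    by measurable
  show ?thesis
    using assms prob_space.prob_space_distr[OF p m]
    by (auto simp: has_exp_moments_def integrable_distr_eq[OF m e] integral_distr[OF m e])
qed

end

theory Submission
  imports Defs
begin

text \<open>
  If \<open>\<xi>\<close> has exponential moment function \<open>exp \<phi>\<close>, then splitting the expectation over the octants
  that contain \<open>\<xi>\<close> gives the functions \<open>F\<^sub>\<epsilon>\<close>, and differentiation under the integral gives the
  signs of their derivatives.

  For the converse, the derivatives of \<open>F\<^sub>\<epsilon>\<close> along any vector of the octant are nonnegative, so by
  Bernstein's argument \<open>F\<^sub>\<epsilon>\<close> is the sum of its Taylor series at \<open>- n \<epsilon>\<close>.  Evaluated at the point with
  coordinates \<open>n \<epsilon>\<^sub>j (exp (\<epsilon>\<^sub>j l\<^sub>j / n) - 1)\<close>, the series is the exponential moment function, at \<open>l\<close>, of a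
  discrete measure on a grid in the octant, and that point tends to \<open>l\<close>.  Summed over \<open>\<epsilon>\<close>, these
  measures are probability measures, so it remains to pass to a weak limit in several dimensions.
  This is reduced to Helly's theorem on the line: the space is mapped into the unit ball, and the
  ball is parametrised by a space-filling curve with a measurable right inverse, along which
  the measures are lifted to the unit interval.
\<close>

section \<open>Partial derivatives of smooth functions\<close>

lemma smooth_foldr_partial: "smooth F \<Longrightarrow> smooth (foldr partial js F)"
  unfolding smooth_def by (metis foldr_append)

lemma smooth_partial: "smooth F \<Longrightarrow> smooth (partial j F)"
  using smooth_foldr_partial[of F "[j]"] by simp

lemma smooth_differentiable: "smooth F \<Longrightarrow> F differentiable (at x)"
  unfolding smooth_def by (metis foldr_Nil id_apply)

lemma smooth_isCont: "smooth F \<Longrightarrow> isCont F x"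
  by (simp add: differentiable_imp_continuous_within smooth_differentiable)

lemma has_derivative_along_line:
  fixes F :: "real^'n::finite \<Rightarrow> real"
  assumes "(F has_derivative D) (at (x + t *\<^sub>R v))"
  shows "((\<lambda>t. F (x + t *\<^sub>R v)) has_real_derivative D v) (at t)"
proof -
  have "((\<lambda>t. x + t *\<^sub>R v) has_derivative (\<lambda>h. h *\<^sub>R v)) (at t)"
    by (auto intro!: derivative_eq_intros)
  from has_derivative_compose[OF this assms]
  show ?thesis
    using linear_cmul[OF has_derivative_linear[OF assms]]
    by (simp add: has_field_derivative_def mult_commute_abs)
qed

lemma partial_eq_derivative:
  assumes "(F has_derivative D) (at x)"
  shows "partial j F x = D (axis j 1)"
  using has_derivative_along_line[of F D x 0 "axis j 1"] assms
  by (simp add: partial_def DERIV_imp_deriv)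

lemma has_real_derivative_partials:
  fixes F :: "real^'n::finite \<Rightarrow> real"
  assumes "F differentiable (at (x + t *\<^sub>R v))"
  shows "((\<lambda>t. F (x + t *\<^sub>R v)) has_real_derivative
           (\<Sum>j\<in>UNIV. v $ j * partial j F (x + t *\<^sub>R v))) (at t)"
proof -
  from assms obtain D where D: "(F has_derivative D) (at (x + t *\<^sub>R v))"
    unfolding differentiable_def by blast
  have "D v = D (\<Sum>j\<in>UNIV. v $ j *\<^sub>R axis j 1)"
    by (simp add: basis_expansion scalar_mult_eq_scaleR[symmetric])
  also have "\<dots> = (\<Sum>j\<in>UNIV. v $ j * partial j F (x + t *\<^sub>R v))"
    using has_derivative_linear[OF D]
    by (simp add: linear_sum linear_cmul partial_eq_derivative[OF D])
  finally show ?thesis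
    using has_derivative_along_line[OF D] by simp
qed

lemma has_real_derivative_partial:
  fixes F :: "real^'n::finite \<Rightarrow> real"
  assumes "smooth F"
  shows "((\<lambda>t. F (x + t *\<^sub>R axis j 1)) has_real_derivative
           partial j F (x + t *\<^sub>R axis j 1)) (at t)"
proof -
  obtain D where D: "(F has_derivative D) (at (x + t *\<^sub>R axis j 1))"
    using smooth_differentiable[OF assms] unfolding differentiable_def by blast
  show ?thesis
    using has_derivative_along_line[OF D] by (simp add: partial_eq_derivative[OF D])
qed

section \<open>Symmetry of mixed partial derivatives\<close>

lemma second_difference_mvt:
  fixes F :: "real^'n::finite \<Rightarrow> real"
  assumes F: "smooth F" and h: "h > 0"
  obtains s t where "0 < s" "s < h" "0 < t" "t < h"
    and "F (x + h *\<^sub>R axis i 1 + h *\<^sub>R axis j 1) - F (x + h *\<^sub>R axis i 1)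
           - F (x + h *\<^sub>R axis j 1) + F x
         = h\<^sup>2 * partial j (partial i F) (x + s *\<^sub>R axis i 1 + t *\<^sub>R axis j 1)"
proof -
  \<comment> \<open>\<open>u\<close> is the increment of \<open>F\<close> over a step
    \<open>h\<close> along axis \<open>j\<close>, as a function of the displacement along axis
    \<open>i\<close>. The mean value theorem for \<open>u\<close> yields \<open>s\<close>; applied
    to \<open>partial i F\<close> along axis \<open>j\<close>, it yields \<open>t\<close>.\<close>
  define u where "u s = F ((x + h *\<^sub>R axis j 1) + s *\<^sub>R axis i 1) - F (x + s *\<^sub>R axis i 1)" for s
  have "(u has_real_derivative partial i F ((x + h *\<^sub>R axis j 1) + s *\<^sub>R axis i 1)
          - partial i F (x + s *\<^sub>R axis i 1)) (at s)" for s
    unfolding u_def by (intro DERIV_diff has_real_derivative_partial F)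
  from MVT2[OF h this] obtain s where s: "0 < s" "s < h"
    and us: "u h - u 0 = h * (partial i F ((x + h *\<^sub>R axis j 1) + s *\<^sub>R axis i 1)
          - partial i F (x + s *\<^sub>R axis i 1))"
    by auto
  have "((\<lambda>t. partial i F ((x + s *\<^sub>R axis i 1) + t *\<^sub>R axis j 1)) has_real_derivative
          partial j (partial i F) ((x + s *\<^sub>R axis i 1) + t *\<^sub>R axis j 1)) (at t)" for t
    by (intro has_real_derivative_partial smooth_partial F)
  from MVT2[OF h this] obtain t where t: "0 < t" "t < h"
    and "partial i F ((x + s *\<^sub>R axis i 1) + h *\<^sub>R axis j 1) - partial i F (x + s *\<^sub>R axis i 1)
       = h * partial j (partial i F) ((x + s *\<^sub>R axis i 1) + t *\<^sub>R axis j 1)"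
    by auto
  with us have "u h - u 0 = h\<^sup>2 * partial j (partial i F) (x + s *\<^sub>R axis i 1 + t *\<^sub>R axis j 1)"
    by (simp add: power2_eq_square algebra_simps)
  with s t show ?thesis
    by (intro that[of s t]) (simp_all add: u_def algebra_simps)
qed

text \<open>The second difference quotient is symmetric in \<open>i\<close> and \<open>j\<close>. By
  \<open>second_difference_mvt\<close> it is a value of either mixed derivative at a point that
  tends to \<open>x\<close>, and both derivatives are continuous.\<close>

lemma partial_commute:
  fixes F :: "real^'n::finite \<Rightarrow> real"
  assumes F: "smooth F"
  shows "partial i (partial j F) x = partial j (partial i F) x"
proof (rule LIMSEQ_unique)
  define h where "h n = inverse (real (Suc n))" for n
  have h: "h n > 0" for n by (simp add: h_def)
  have h0: "h \<longlonglongrightarrow> 0"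
    unfolding h_def by (rule LIMSEQ_inverse_real_of_nat)
  define \<Delta> where "\<Delta> i j n = (F (x + h n *\<^sub>R axis i 1 + h n *\<^sub>R axis j 1) - F (x + h n *\<^sub>R axis i 1)
           - F (x + h n *\<^sub>R axis j 1) + F x) / (h n)\<^sup>2" for i j n
  have lim: "\<Delta> i j \<longlonglongrightarrow> partial j (partial i F) x" for i j
  proof -
    have "\<exists>s t. 0 < s \<and> s < h n \<and> 0 < t \<and> t < h n \<and>
        \<Delta> i j n = partial j (partial i F) (x + s *\<^sub>R axis i 1 + t *\<^sub>R axis j 1)" for n
      by (rule second_difference_mvt[OF F h, of n x i j]) (use h[of n] in \<open>auto simp: \<Delta>_def\<close>)
    then obtain s t where st: "\<And>n. 0 < s n \<and> s n < h n \<and> 0 < t n \<and> t n < h n"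
      and \<Delta>: "\<And>n. \<Delta> i j n = partial j (partial i F) (x + s n *\<^sub>R axis i 1 + t n *\<^sub>R axis j 1)"
      by metis
    have "s \<longlonglongrightarrow> 0" "t \<longlonglongrightarrow> 0"
      by (rule tendsto_sandwich[OF _ _ tendsto_const h0]; use st in \<open>auto intro!: always_eventually less_imp_le\<close>)+
    then have "(\<lambda>n. x + s n *\<^sub>R axis i 1 + t n *\<^sub>R axis j 1) \<longlonglongrightarrow> x + 0 *\<^sub>R axis i 1 + 0 *\<^sub>R axis j 1"
      by (intro tendsto_intros)
    then have "(\<lambda>n. partial j (partial i F) (x + s n *\<^sub>R axis i 1 + t n *\<^sub>R axis j 1))
        \<longlonglongrightarrow> partial j (partial i F) x"
      by (intro isCont_tendsto_compose[OF smooth_isCont] smooth_partial F) simp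
    moreover have "\<Delta> i j = (\<lambda>n. partial j (partial i F) (x + s n *\<^sub>R axis i 1 + t n *\<^sub>R axis j 1))"
      by (rule ext) (rule \<Delta>)
    ultimately show ?thesis
      by simp
  qed
  have "\<Delta> i j = \<Delta> j i"
    by (simp add: \<Delta>_def fun_eq_iff algebra_simps)
  then show "\<Delta> j i \<longlonglongrightarrow> partial j (partial i F) x"
    using lim[of i j] by simp
  show "\<Delta> j i \<longlonglongrightarrow> partial i (partial j F) x"
    by (rule lim)
qed

lemma partial_foldr_partial:
  assumes "smooth F"
  shows "partial i (foldr partial js F) = foldr partial js (partial i F)"
proof (induction js)
  case (Cons j js)
  have "partial i (partial j (foldr partial js F)) = partial j (partial i (foldr partial js F))"
    by (rule ext) (rule partial_commute[OF smooth_foldr_partial[OF assms]])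
  then show ?case
    using Cons by simp
qed simp

text \<open>The first letter of \<open>js\<close> is located in \<open>js'\<close> and moved to the
  front, past the letters before it, by \<open>partial_foldr_partial\<close>.\<close>

lemma foldr_partial_mset_cong:
  assumes F: "smooth F" and "mset js = mset js'"
  shows "foldr partial js F = foldr partial js' F"
  using assms(2)
proof (induction js arbitrary: js')
  case (Cons i js)
  then obtain as bs where js': "js' = as @ i # bs"
    by (metis list.set_intros(1) set_mset_mset split_list)
  with Cons.prems have "mset js = mset (as @ bs)"
    by simp
  then have "foldr partial js F = foldr partial (as @ bs) F"
    by (rule Cons.IH)
  then show ?case
    using partial_foldr_partial[OF smooth_foldr_partial[OF F], of i as bs] by (simp add: js')
qed simp

section \<open>Multi-indices as words in the coordinates\<close>

definition multi_list :: "('n::finite \<Rightarrow> nat) \<Rightarrow> 'n list" where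
  "multi_list k = concat (map (\<lambda>j. replicate (k j) j) coords)"

lemma multi_partial_eq_foldr: "multi_partial k F = foldr partial (multi_list k) F"
proof -
  have "(partial j ^^ n) G = foldr partial (replicate n j) G" for j n and G :: "real^'n \<Rightarrow> real"
    by (induction n) auto
  then have "foldr (\<lambda>j G. (partial j ^^ k j) G) cs F
      = foldr partial (concat (map (\<lambda>j. replicate (k j) j) cs)) F" for cs
    by (induction cs) auto
  then show ?thesis
    by (simp add: multi_partial_def multi_list_def)
qed

lemma coords: "distinct (coords :: 'n::finite list)" "set (coords :: 'n list) = UNIV"
proof -
  have "\<exists>js :: 'n list. distinct js \<and> set js = UNIV"
    using finite_distinct_list[of "UNIV :: 'n set"] by auto
  from someI_ex[OF this] show "distinct (coords :: 'n list)" "set (coords :: 'n list) = UNIV"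
    by (auto simp: coords_def)
qed

lemma prod_list_multi_list:
  "(\<Prod>j\<leftarrow>multi_list k. f j) = (\<Prod>j\<in>UNIV. f j ^ k j)"
  for f :: "'n::finite \<Rightarrow> real"
proof -
  have "(\<Prod>j\<leftarrow>concat (map (\<lambda>j. replicate (k j) j) cs). f j) = (\<Prod>j\<leftarrow>cs. f j ^ k j)" for cs
    by (induction cs) (auto simp: prod_list_replicate)
  then show ?thesis
    by (simp add: multi_list_def coords flip: prod.distinct_set_conv_list)
qed

text \<open>Every word is a rearrangement of the standard word of its own multi-index, so sign
  conditions on multi-indices pass to arbitrary words.\<close>

lemma mset_multi_list_count: "mset (multi_list (\<lambda>j. count (mset js) j)) = mset js"
proof (rule multiset_eqI)
  fix i
  have "count (mset (concat (map (\<lambda>j. replicate (k j) j) cs))) i = (if i \<in> set cs then k i else 0)"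
    if "distinct cs" for cs and k :: "'a \<Rightarrow> nat"
    using that by (induction cs) (auto simp: count_eq_zero_iff)
  then show "count (mset (multi_list (count (mset js)))) i = count (mset js) i"
    by (simp add: multi_list_def coords)
qed

lemma prod_list_mset_cong:
  "mset js = mset js' \<Longrightarrow> (\<Prod>j\<leftarrow>js. f j) = (\<Prod>j\<leftarrow>js'. f j :: real)"
  by (metis mset_map prod_mset_prod_list)

text \<open>Up to the order of differentiation, \<open>js\<close> is a multi-index \<open>k\<close>.
  A derivative whose sign is 0 or equals the product of the \<open>\<epsilon> $ j\<close> has a
  nonnegative product with it. The empty word gives nonnegativity of \<open>F\<close>
  itself.\<close>

lemma octant_monotonic_sign:
  assumes F: "F \<in> octant_monotonic \<epsilon>"
  shows "0 \<le> (\<Prod>j\<leftarrow>js. \<epsilon> $ j) * foldr partial js F x"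
proof -
  define k where "k = (\<lambda>j. count (mset js) j)"
  have m: "mset (multi_list k) = mset js"
    unfolding k_def by (rule mset_multi_list_count)
  have "smooth F" and sgn: "sgn (multi_partial k F x) \<in> {0, multi_power \<epsilon> k}"
    using F by (auto simp: octant_monotonic_def)
  then have "multi_partial k F x = foldr partial js F x"
    using foldr_partial_mset_cong[OF _ m] by (simp add: multi_partial_eq_foldr)
  moreover have "multi_power \<epsilon> k = (\<Prod>j\<leftarrow>js. \<epsilon> $ j)"
    by (simp add: multi_power_def prod_list_mset_cong[OF m] flip: prod_list_multi_list)
  ultimately show ?thesis
    using sgn by (auto simp: sgn_if zero_le_mult_iff split: if_splits)
qed

section \<open>A space-filling curve\<close>

text \<open>A continuous function of period 2 that is 0 within distance 1/3 of the even integers and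
  1 within distance 1/3 of the odd ones.\<close>

definition bump :: "real \<Rightarrow> real" where
  "bump t = max 0 (min 1 (1/2 - cos (pi * t)))"

lemma bump_bounds: "0 \<le> bump t" "bump t \<le> 1"
  by (auto simp: bump_def)

lemma bump_digit:
  assumes "b = 0 \<or> b = 1" "0 \<le> r" "r \<le> 1/3"
  shows "bump (2 * of_int k + (2 * b / 3 + r)) = b"
proof -
  have "cos (pi * (2 * of_int k + (2 * b / 3 + r))) = cos (pi * (2 * b / 3 + r))"
    using cos.plus_of_int[of "pi * (2 * b / 3 + r)" k] by (simp add: algebra_simps)
  moreover have "cos (pi * (2 * b / 3 + r)) \<ge> 1/2" if "b = 0"
    using cos_monotone_0_pi_le[of "pi * r" "pi / 3"] assms that by (simp add: cos_60)
  moreover have "cos (pi * (2 * b / 3 + r)) \<le> - 1/2" if "b = 1"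
    using cos_monotone_0_pi_le[of "pi * 2 / 3" "pi * (2/3 + r)"] assms that
    by (simp add: cos_120')
  ultimately show ?thesis
    using assms(1) by (auto simp: bump_def)
qed

definition cantor_code :: "(nat \<Rightarrow> real) \<Rightarrow> real" where
  "cantor_code b = (\<Sum>k. 2 * b k / 3 ^ Suc k)"

lemma cantor_series_sums: "(\<lambda>k. 2 / 3 ^ Suc k) sums (1::real)"
  using sums_mult[OF geometric_sums[of "1/3::real"], of "2/3"]
  by (simp add: power_one_over field_simps)

lemma
  assumes "\<And>k. b k \<in> {0..1}"
  shows cantor_code_summable: "summable (\<lambda>k. 2 * b k / 3 ^ Suc k)"
    and cantor_code_bounds: "cantor_code b \<in> {0..1}"
proof -
  have le: "2 * b k / 3 ^ Suc k \<le> 2 / 3 ^ Suc k" and ge: "0 \<le> 2 * b k / 3 ^ Suc k" for k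
    using assms[of k] by (auto simp: divide_le_cancel)
  note s = sums_summable[OF cantor_series_sums]
  show sm: "summable (\<lambda>k. 2 * b k / 3 ^ Suc k)"
    using le ge by (intro summable_comparison_test'[OF s, of 0]) (simp only: real_norm_def abs_of_nonneg)
  show "cantor_code b \<in> {0..1}"
    using suminf_nonneg[OF sm ge] suminf_le[OF le sm s] sums_unique[OF cantor_series_sums]
    by (simp add: cantor_code_def)
qed

text \<open>After multiplication by \<open>3 ^ k\<close>, the digits before place \<open>k\<close>
  form an even integer, which the period of \<open>bump\<close> removes. Digit \<open>k\<close>
  contributes 0 or 2/3, and the later ones at most 1/3, within the tolerance of
  \<open>bump_digit\<close>.\<close>

lemma bump_cantor_code:
  assumes b: "\<And>k. b k = 0 \<or> b k = 1"
  shows "bump (3 ^ k * cantor_code b) = b k"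
proof -
  define f where "f i = 2 * b i / 3 ^ Suc i" for i
  have b01: "b i \<in> {0..1}" for i
    using b[of i] by auto
  note sm = cantor_code_summable[of b, OF b01, folded f_def]
  define r where "r = 3 ^ k * (\<Sum>i. f (i + Suc k))"
  \<comment> \<open>Up to the factor 1/3 the tail is the code of the shifted digit sequence, which
    lies in [0, 1].\<close>
  have "3 ^ k * f (i + Suc k) = 2 * b (i + Suc k) / 3 ^ Suc i / 3" for i
    by (simp add: f_def power_add field_simps)
  then have "r = cantor_code (\<lambda>i. b (i + Suc k)) / 3"
    unfolding r_def cantor_code_def
    by (simp only: suminf_mult[OF summable_ignore_initial_segment[OF sm], symmetric]
        suminf_divide[OF cantor_code_summable[of "\<lambda>i. b (i + Suc k)", OF b01], symmetric])
  with cantor_code_bounds[of "\<lambda>i. b (i + Suc k)", OF b01] have r: "0 \<le> r" "r \<le> 1/3"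
    by auto
  have "\<exists>m. 3 ^ k * (\<Sum>i<k. f i) = 2 * of_int m"
  proof (induction k)
    case (Suc k)
    then obtain m where "3 ^ k * (\<Sum>i<k. f i) = 2 * of_int m" by blast
    then have "3 ^ Suc k * (\<Sum>i<Suc k. f i) = 2 * of_int (3 * m + (if b k = 0 then 0 else 1))"
      using b[of k] by (auto simp: f_def algebra_simps)
    then show ?case by blast
  qed auto
  then obtain m where m: "3 ^ k * (\<Sum>i<k. f i) = 2 * of_int m" by blast
  have "3 ^ k * cantor_code b = 3 ^ k * (\<Sum>i<Suc k. f i) + r"
    using suminf_split_initial_segment[OF sm, of "Suc k"]
    by (simp add: cantor_code_def r_def f_def algebra_simps)
  also have "\<dots> = 2 * of_int m + (2 * b k / 3 + r)"
    using m by (simp add: f_def algebra_simps)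
  finally show ?thesis
    using bump_digit[OF b[of k] r] by simp
qed

definition binary_digit :: "nat \<Rightarrow> real \<Rightarrow> real" where
  "binary_digit i z = of_int (\<lfloor>2 ^ Suc i * z\<rfloor> - 2 * \<lfloor>2 ^ i * z\<rfloor>)"

lemma binary_digit_cases: "binary_digit i z = 0 \<or> binary_digit i z = 1"
proof -
  have "\<lfloor>2 ^ Suc i * z\<rfloor> - 2 * \<lfloor>2 ^ i * z\<rfloor> \<in> {0, 1}"
    using floor_correct[of "2 ^ i * z"] floor_correct[of "2 ^ Suc i * z"]
    by (simp, linarith)
  then show ?thesis
    by (auto simp: binary_digit_def)
qed

text \<open>The series telescopes: its partial sums are the dyadic truncations \<open>f i\<close> of
  \<open>z\<close>, which lie at most \<open>(1/2) ^ i\<close> below \<open>z\<close>. The bounds on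
  \<open>z\<close> make \<open>f 0\<close> vanish.\<close>

lemma binary_digit_sums:
  assumes "0 \<le> z" "z < 1"
  shows "(\<lambda>i. binary_digit i z / 2 ^ Suc i) sums z"
proof -
  define f :: "nat \<Rightarrow> real" where "f i = of_int \<lfloor>2 ^ i * z\<rfloor> / 2 ^ i" for i
  have "f \<longlonglongrightarrow> z"
  proof (rule tendsto_sandwich)
    have "z - (1/2) ^ i \<le> f i" for i
    proof -
      have "(2 ^ i * z - 1) / 2 ^ i \<le> f i"
        unfolding f_def by (rule divide_right_mono) (linarith, simp)
      then show ?thesis
        by (simp add: diff_divide_distrib power_one_over)
    qed
    then show "\<forall>\<^sub>F i in sequentially. z - (1/2) ^ i \<le> f i"
      by simp
    show "\<forall>\<^sub>F i in sequentially. f i \<le> z"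
      using floor_correct by (auto simp: f_def field_simps intro!: always_eventually)
    have "(\<lambda>i. (1/2::real) ^ i) \<longlonglongrightarrow> 0"
      by (rule LIMSEQ_power_zero) simp
    from tendsto_diff[OF tendsto_const[of z] this] show "(\<lambda>i. z - (1/2) ^ i) \<longlonglongrightarrow> z"
      by simp
  qed simp
  moreover have "f (Suc i) - f i = binary_digit i z / 2 ^ Suc i" for i
    by (simp add: f_def binary_digit_def field_simps)
  moreover have "f 0 = 0"
    using assms by (simp add: f_def floor_eq_iff)
  ultimately show ?thesis
    using telescope_sums[of f z] by simp
qed

text \<open>Schoenberg's space-filling curve: the \<open>k\<close>-th ternary digit of the parameter, read off by
  \<open>bump\<close>, becomes a binary digit of one coordinate.\<close>

lemma space_filling_curve:
  obtains h :: "real \<Rightarrow> real^'n::finite" and c :: "real^'n \<Rightarrow> real"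
  where "continuous_on UNIV h" "c \<in> borel_measurable borel" "\<And>y. c y \<in> {0..1}"
    and "\<And>y. norm y < 1 \<Longrightarrow> h (c y) = y"
proof -
  \<comment> \<open>The injection \<open>e\<close> reserves a ternary place for every binary digit
    of every coordinate; places outside its range carry the digit 0.\<close>
  obtain e :: "'n \<times> nat \<Rightarrow> nat" where e: "inj e"
    by (meson countableE countable_SIGMA countable_finite countableI_type finite_code UNIV_Times_UNIV)
  define h :: "real \<Rightarrow> real^'n" where
    "h t = (\<chi> j. 2 * (\<Sum>i. bump (3 ^ e (j, i) * t) / 2 ^ Suc i) - 1)" for t
  define b where "b y k = (if k \<in> range e then case inv e k of (j, i) \<Rightarrow> binary_digit i ((y $ j + 1) / 2) else 0)"
    for y :: "real^'n" and k
  have b01: "b y k = 0 \<or> b y k = 1" for y k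
    using binary_digit_cases by (auto simp: b_def split: prod.split)
  define c where "c y = cantor_code (b y)" for y
  have "continuous_on UNIV (\<lambda>t. \<Sum>i. bump (3 ^ e (j, i) * t) / 2 ^ Suc i)" for j
  proof (rule uniform_limit_theorem)
    have "summable (\<lambda>i. 1 / 2 ^ Suc i :: real)"
      using sums_summable[OF power_half_series] by (simp add: power_one_over)
    then show "uniform_limit UNIV (\<lambda>n t. \<Sum>i<n. bump (3 ^ e (j, i) * t) / 2 ^ Suc i)
        (\<lambda>t. \<Sum>i. bump (3 ^ e (j, i) * t) / 2 ^ Suc i) sequentially"
      by (intro Weierstrass_m_test[where M = "\<lambda>i. 1 / 2 ^ Suc i"])
        (auto simp: bump_bounds divide_right_mono)
    show "\<forall>\<^sub>F n in sequentially. continuous_on UNIV (\<lambda>t. \<Sum>i<n. bump (3 ^ e (j, i) * t) / 2 ^ Suc i)"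
      unfolding bump_def by (intro always_eventually allI continuous_intros) auto
  qed simp
  then have "continuous_on UNIV h"
    unfolding h_def by (intro continuous_on_vec_lambda continuous_intros)
  moreover have "c \<in> borel_measurable borel"
  proof -
    have "(\<lambda>y. b y k) \<in> borel_measurable borel" for k
      unfolding b_def binary_digit_def by (auto split: prod.split)
    then show ?thesis
      unfolding c_def cantor_code_def by measurable
  qed
  moreover have "c y \<in> {0..1}" for y
    unfolding c_def using b01[of y] by (intro cantor_code_bounds) (metis atLeastAtMost_iff order.refl zero_le_one)
  moreover have "h (c y) = y" if "norm y < 1" for y
  proof (rule vec_eq_iff[THEN iffD2], rule allI)
    fix j
    have "bump (3 ^ e (j, i) * c y) = binary_digit i ((y $ j + 1) / 2)" for i
      using bump_cantor_code[of "b y" "e (j, i)", OF b01] inv_f_f[OF e] by (simp add: b_def c_def)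
    \<comment> \<open>Coordinates of a point in the open unit ball lie in (-1, 1); rescaled to (0,
      1), they are the sums of their binary digits.\<close>
    moreover have "(\<lambda>i. binary_digit i ((y $ j + 1) / 2) / 2 ^ Suc i) sums ((y $ j + 1) / 2)"
      using component_le_norm_cart[of y j] that by (intro binary_digit_sums) auto
    ultimately show "h (c y) $ j = y $ j"
      using sums_unique by (fastforce simp: h_def)
  qed
  ultimately show ?thesis
    by (rule that)
qed

section \<open>Limits of exponential moment functions\<close>

lemma norm_le_inner_sign:
  obtains \<sigma> :: "real^'n::finite" where "\<sigma> \<in> signs" "norm x \<le> \<sigma> \<bullet> x"
proof
  let ?\<sigma> = "(\<chi> i. if 0 \<le> x $ i then 1 else -1) :: real^'n"
  show "?\<sigma> \<in> signs"
    by (simp add: signs_def)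
  have "(\<Sum>i\<in>UNIV. \<bar>x $ i\<bar>) = ?\<sigma> \<bullet> x"
    by (auto simp: inner_vec_def intro!: sum.cong)
  then show "norm x \<le> ?\<sigma> \<bullet> x"
    using norm_le_l1_cart[of x] by simp
qed

text \<open>The norm is at most the sum of the absolute coordinates, which is
  \<open>\<sigma> \<bullet> x\<close> for some sign vector. Growth in the norm is thus controlled by
  finitely many exponentials of linear forms, whose integrals are known.\<close>

lemma exp_norm_le_sum_signs:
  fixes l x :: "real^'n::finite"
  assumes "0 \<le> k"
  shows "exp (l \<bullet> x + k * norm x) \<le> (\<Sum>\<sigma>\<in>signs. exp ((l + k *\<^sub>R \<sigma>) \<bullet> x))"
proof -
  obtain \<sigma> :: "real^'n" where \<sigma>: "\<sigma> \<in> signs" "norm x \<le> \<sigma> \<bullet> x"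
    by (rule norm_le_inner_sign)
  then have "exp (l \<bullet> x + k * norm x) \<le> exp ((l + k *\<^sub>R \<sigma>) \<bullet> x)"
    using mult_left_mono[OF \<sigma>(2) assms] by (simp add: inner_add_left)
  also have "\<dots> \<le> (\<Sum>\<sigma>\<in>signs. exp ((l + k *\<^sub>R \<sigma>) \<bullet> x))"
    using \<sigma>(1) finite_signs by (intro member_le_sum) auto
  finally show ?thesis .
qed

text \<open>Piecewise linear: 1 if \<open>1 - u\<close> is at least \<open>2 / real (Suc m)\<close>,
  and 0 if it is at most \<open>1 / real (Suc m)\<close>.\<close>

definition cutoff :: "nat \<Rightarrow> real \<Rightarrow> real" where
  "cutoff m u = max 0 (min 1 (real (Suc m) * (1 - u) - 1))"

lemma cutoff_bounds: "0 \<le> cutoff m u" "cutoff m u \<le> 1"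
  by (auto simp: cutoff_def)

lemma cutoff_eq_0: "1 - u \<le> 1 / real (Suc m) \<Longrightarrow> cutoff m u = 0"
  by (auto simp: cutoff_def field_simps max_def min_def)

lemma cutoff_mono:
  assumes "m \<le> n"
  shows "cutoff m u \<le> cutoff n u"
proof (cases "u < 1")
  case True
  then have "real (Suc m) * (1 - u) \<le> real (Suc n) * (1 - u)"
    using assms by (intro mult_right_mono) auto
  then show ?thesis
    by (auto simp: cutoff_def)
next
  case False
  then have "cutoff m u = 0"
    by (intro cutoff_eq_0) (auto intro: order_trans[of _ 0])
  then show ?thesis
    by (simp add: cutoff_bounds)
qed

text \<open>Either the cutoff is 1 or the bound exceeds 1. For \<open>u = norm (to_ball x)\<close>
  the bound is a multiple of \<open>1 + norm x\<close>, a growth that exponential moments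
  absorb.\<close>

lemma one_minus_cutoff_le:
  assumes "u < 1"
  shows "1 - cutoff m u \<le> 2 / (real (Suc m) * (1 - u))"
proof (cases "real (Suc m) * (1 - u) \<ge> 2")
  case True
  then have "cutoff m u = 1"
    by (simp add: cutoff_def)
  then show ?thesis
    using assms by simp
next
  case False
  then have "1 \<le> 2 / (real (Suc m) * (1 - u))"
    using assms by (simp add: pos_le_divide_eq)
  then show ?thesis
    using cutoff_bounds[of m u] by linarith
qed

lemma cutoff_tendsto: "(\<lambda>m. cutoff m u) \<longlonglongrightarrow> indicator {..<1} u"
proof (cases "u < 1")
  case True
  have "(\<lambda>m. 2 / (1 - u) * inverse (real (Suc m))) \<longlonglongrightarrow> 2 / (1 - u) * 0"
    by (intro tendsto_intros LIMSEQ_inverse_real_of_nat)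
  then have *: "(\<lambda>m. 1 - 2 / (real (Suc m) * (1 - u))) \<longlonglongrightarrow> 1 - 0"
    by (intro tendsto_intros) (simp add: field_simps)
  have "(\<lambda>m. cutoff m u) \<longlonglongrightarrow> 1"
  proof (rule tendsto_sandwich)
    show "\<forall>\<^sub>F m in sequentially. 1 - 2 / (real (Suc m) * (1 - u)) \<le> cutoff m u"
      using one_minus_cutoff_le[OF True] by (intro always_eventually allI) (smt (verit, best))
    show "(\<lambda>m. 1 - 2 / (real (Suc m) * (1 - u))) \<longlonglongrightarrow> 1"
      using * by simp
  qed (auto simp: cutoff_bounds)
  then show ?thesis
    using True by simp
next
  case False
  then have "cutoff m u = 0" for m
    by (intro cutoff_eq_0) (auto intro: order_trans[of _ 0])
  then show ?thesis
    using False by simp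
qed

section \<open>Transport of the space to the unit ball\<close>

definition to_ball :: "'a::real_normed_vector \<Rightarrow> 'a" where
  "to_ball x = x /\<^sub>R (1 + norm x)"

definition from_ball :: "'a::real_normed_vector \<Rightarrow> 'a" where
  "from_ball y = y /\<^sub>R (1 - norm y)"

lemma one_minus_norm_to_ball: "1 - norm (to_ball x) = 1 / (1 + norm x)"
proof -
  have "1 + norm x > 0"
    by (simp add: add_pos_nonneg)
  then show ?thesis
    by (simp add: to_ball_def field_simps)
qed

lemma norm_to_ball_less: "norm (to_ball x) < 1"
proof -
  have "1 / (1 + norm x) > 0"
    by (simp add: add_pos_nonneg)
  then show ?thesis
    using one_minus_norm_to_ball[of x] by linarith
qed

lemma from_to_ball: "from_ball (to_ball x) = x"
proof -
  have "1 + norm x > 0"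
    by (simp add: add_pos_nonneg)
  then show ?thesis
    by (simp add: from_ball_def one_minus_norm_to_ball) (simp add: to_ball_def)
qed

text \<open>The exponential \<open>x \<mapsto> exp (l \<bullet> x)\<close>, transported to the unit ball and cut off near its
  boundary.  The \<open>max\<close> only matters where the cutoff vanishes; it makes the function continuous
  on the whole space.\<close>

definition ball_exp :: "nat \<Rightarrow> 'a::real_inner \<Rightarrow> 'a \<Rightarrow> real" where
  "ball_exp m l y = exp (l \<bullet> y / max (1 / real (Suc m)) (1 - norm y)) * cutoff m (norm y)"

lemma ball_exp_eq: "ball_exp m l y = exp (l \<bullet> from_ball y) * cutoff m (norm y)"
proof (cases "1 - norm y \<le> 1 / real (Suc m)")
  case True
  then show ?thesis
    by (simp add: ball_exp_def cutoff_eq_0 del: of_nat_Suc)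
next
  case False
  then show ?thesis
    by (simp add: ball_exp_def from_ball_def max_def divide_inverse mult.commute)
qed

lemma continuous_ball_exp: "continuous_on UNIV (ball_exp m l)"
proof -
  have "max (1 / real (Suc m)) (1 - norm y) \<noteq> 0" for y :: 'a
    by (metis max.cobounded1 of_nat_0_less_iff zero_less_Suc zero_less_divide_1_iff less_le_not_le)
  then show ?thesis
    unfolding ball_exp_def cutoff_def by (intro continuous_intros) auto
qed

text \<open>Where the cutoff is nonzero, \<open>1 / (1 - norm y)\<close> is at most
  \<open>real (Suc m)\<close>, which bounds the exponent. Boundedness and continuity make these
  functions admissible for weak convergence.\<close>

lemma ball_exp_bound: "\<bar>ball_exp m l y\<bar> \<le> exp (norm l * real (Suc m))"
proof (cases "1 - norm y \<le> 1 / real (Suc m)")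
  case True
  then show ?thesis
    by (simp add: ball_exp_def cutoff_eq_0 del: of_nat_Suc)
next
  case False
  moreover have "1 / real (Suc m) > 0"
    by simp
  ultimately have pos: "1 - norm y > 0" and y: "norm y \<le> 1"
    by linarith+
  with False have inv: "1 / (1 - norm y) \<le> real (Suc m)"
    by (simp add: field_simps del: of_nat_Suc)
  have "l \<bullet> y \<le> norm l"
    using norm_cauchy_schwarz[of l y] mult_left_mono[OF y norm_ge_zero, of l] by simp
  then have "l \<bullet> from_ball y \<le> norm l * (1 / (1 - norm y))"
    using pos mult_right_mono[of "l \<bullet> y" "norm l" "1 / (1 - norm y)"]
    by (simp add: from_ball_def divide_inverse mult.commute)
  also have "\<dots> \<le> norm l * real (Suc m)"
    by (intro mult_left_mono inv) auto
  finally have "exp (l \<bullet> from_ball y) * cutoff m (norm y) \<le> exp (norm l * real (Suc m)) * 1"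
    by (intro mult_mono) (auto simp: cutoff_bounds)
  then show ?thesis
    by (simp add: ball_exp_eq cutoff_bounds)
qed

lemma ball_exp_mono: "m \<le> n \<Longrightarrow> ball_exp m l y \<le> ball_exp n l y"
  by (simp add: ball_exp_eq cutoff_mono)

text \<open>The cutoff error is at most a multiple of \<open>(1 + norm x) / real (Suc m)\<close>,
  and \<open>1 + norm x\<close> is absorbed by \<open>exp (norm x)\<close>. Integrated, the bound
  involves only values of the moment function at the points \<open>l + \<sigma>\<close>, so it is
  uniform along a convergent sequence.\<close>

lemma ball_exp_to_ball:
  "\<bar>exp (l \<bullet> x) - ball_exp m l (to_ball x)\<bar>
    \<le> 2 / real (Suc m) * (\<Sum>\<sigma>\<in>signs. exp ((l + \<sigma>) \<bullet> x))"
proof -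
  let ?u = "norm (to_ball x)"
  have "\<bar>exp (l \<bullet> x) - ball_exp m l (to_ball x)\<bar> = exp (l \<bullet> x) * (1 - cutoff m ?u)"
    by (simp add: ball_exp_eq from_to_ball cutoff_bounds abs_mult flip: right_diff_distrib')
      (simp add: right_diff_distrib cutoff_bounds)
  also have "\<dots> \<le> exp (l \<bullet> x) * (2 / real (Suc m) * (1 + norm x))"
    using one_minus_cutoff_le[OF norm_to_ball_less, of m x]
    by (intro mult_left_mono) (simp_all add: one_minus_norm_to_ball)
  also have "\<dots> \<le> exp (l \<bullet> x) * (2 / real (Suc m) * exp (norm x))"
    by (intro mult_left_mono exp_ge_add_one_self) auto
  also have "\<dots> = 2 / real (Suc m) * exp (l \<bullet> x + 1 * norm x)"
    by (simp add: exp_add)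
  also have "\<dots> \<le> 2 / real (Suc m) * (\<Sum>\<sigma>\<in>signs. exp ((l + 1 *\<^sub>R \<sigma>) \<bullet> x))"
    by (intro mult_left_mono exp_norm_le_sum_signs) auto
  finally show ?thesis
    by simp
qed

lemma tight_unit_interval:
  assumes "\<And>n. real_distribution (\<mu> n)" and "\<And>n. AE t in \<mu> n. t \<in> {0..1}"
  shows "tight \<mu>"
  unfolding tight_def
proof (intro conjI allI impI)
  fix e :: real assume "e > 0"
  \<comment> \<open>The intervals in \<open>tight\<close> are open on the left, so the left end -1
    keeps 0 inside.\<close>
  have "measure (\<mu> n) {-1<..1} > 1 - e" for n
  proof -
    interpret real_distribution "\<mu> n" by fact
    have "measure (\<mu> n) {-1<..1} = 1"
      using assms(2)[of n] by (subst prob_eq_1) (auto elim: eventually_mono)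
    with \<open>e > 0\<close> show ?thesis by simp
  qed
  then show "\<exists>a b. a < b \<and> (\<forall>n. measure (\<mu> n) {a<..b} > 1 - e)"
    by (intro exI[of _ "-1"] exI[of _ 1]) auto
qed (rule assms)

text \<open>The lifted laws on the unit interval have a weakly convergent subsequence. With the
  cutoff \<open>m\<close> fixed, \<open>n\<close> tends to infinity and \<open>approx\<close>
  survives as \<open>approx'\<close>; then \<open>m\<close> tends to infinity by monotone
  convergence.\<close>

lemma exp_moments_limit:
  fixes X :: "nat \<Rightarrow> 'w \<Rightarrow> real^'n::finite"
  assumes N: "\<And>n. has_exp_moments (N n) (X n) (L n)"
    and L: "\<And>l. (\<lambda>n. L n l) \<longlonglongrightarrow> L' l"
  shows "\<exists>(M :: real measure) \<xi>. has_exp_moments M \<xi> L'"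
proof -
  have prob: "prob_space (N n)" and X [measurable]: "X n \<in> borel_measurable (N n)"
    and int: "integrable (N n) (\<lambda>w. exp (l \<bullet> X n w))"
    and L_eq: "(\<integral>w. exp (l \<bullet> X n w) \<partial>N n) = L n l" for n l
    using N[of n] by (auto simp: has_exp_moments_def)
  obtain h :: "real \<Rightarrow> real^'n" and c :: "real^'n \<Rightarrow> real"
    where h: "continuous_on UNIV h" and c [measurable]: "c \<in> borel_measurable borel"
      and c01: "\<And>y. c y \<in> {0..1}" and hc: "\<And>y. norm y < 1 \<Longrightarrow> h (c y) = y"
    using space_filling_curve by blast
  have hm [measurable]: "h \<in> borel_measurable borel"
    by (rule borel_measurable_continuous_onI[OF h])
  have bm [measurable]: "to_ball \<in> borel_measurable (borel :: (real^'n) measure)"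
      "from_ball \<in> borel_measurable (borel :: (real^'n) measure)"
    unfolding to_ball_def[abs_def] from_ball_def[abs_def] by measurable
  define T where "T n w = c (to_ball (X n w))" for n w
  have T [measurable]: "T n \<in> borel_measurable (N n)" for n
    unfolding T_def by measurable
  have hT: "h (T n w) = to_ball (X n w)" for n w
    by (simp add: T_def hc norm_to_ball_less)
  define \<mu> where "\<mu> n = distr (N n) borel (T n)" for n
  have \<mu>: "real_distribution (\<mu> n)" for n
    unfolding \<mu>_def by (rule prob_space.real_distribution_distr[OF prob T])
  have "AE t in \<mu> n. t \<in> {0..1}" for n
    unfolding \<mu>_def by (subst AE_distr_iff) (use c01 in \<open>auto simp: T_def\<close>)
  with \<mu> have "tight \<mu>"
    by (rule tight_unit_interval)
  from tight_imp_convergent_subsubsequence[OF this strict_mono_id]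
  obtain r M where r: "strict_mono r" and M: "real_distribution M" and w: "weak_conv_m (\<mu> \<circ> r) M"
    by auto
  interpret M: real_distribution M by fact
  define G where "G m l t = ball_exp m l (h t)" for m l t
  have G_cont: "continuous_on UNIV (G m l)" for m l
    unfolding G_def by (rule continuous_on_compose2[OF continuous_ball_exp h]) auto
  have G_meas [measurable]: "G m l \<in> borel_measurable borel" for m l
    by (rule borel_measurable_continuous_onI[OF G_cont])
  have G_bd: "norm (G m l t) \<le> exp (norm l * real (Suc m))" for m l t
    unfolding G_def real_norm_def by (rule ball_exp_bound)
  have G_int: "integrable M (G m l)" for m l
    using G_bd by (intro M.integrable_const_bound[where B = "exp (norm l * real (Suc m))"]) auto
  have conv: "(\<lambda>n. integral\<^sup>L (\<mu> (r n)) (G m l)) \<longlonglongrightarrow> integral\<^sup>L M (G m l)" for m l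
    using weak_conv_imp_integral_bdd_continuous_conv[OF _ M w, of "G m l", OF _ _ G_bd] \<mu> G_cont
    by (auto simp: continuous_on_eq_continuous_at)
  have approx: "\<bar>L n l - integral\<^sup>L (\<mu> n) (G m l)\<bar> \<le> 2 / real (Suc m) * (\<Sum>\<sigma>\<in>signs. L n (l + \<sigma>))" for n m l
  proof -
    interpret prob_space "N n" by (rule prob)
    have i: "integrable (N n) (\<lambda>w. G m l (T n w))"
      using G_bd by (intro integrable_const_bound[where B = "exp (norm l * real (Suc m))"]) auto
    have "integral\<^sup>L (\<mu> n) (G m l) = (\<integral>w. G m l (T n w) \<partial>N n)"
      unfolding \<mu>_def by (rule integral_distr) auto
    then have "L n l - integral\<^sup>L (\<mu> n) (G m l) = (\<integral>w. exp (l \<bullet> X n w) - G m l (T n w) \<partial>N n)"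
      using i int by (simp add: L_eq)
    also have "\<bar>\<dots>\<bar> \<le> (\<integral>w. \<bar>exp (l \<bullet> X n w) - G m l (T n w)\<bar> \<partial>N n)"
      by (rule integral_abs_bound)
    also have "\<dots> \<le> (\<integral>w. 2 / real (Suc m) * (\<Sum>\<sigma>\<in>signs. exp ((l + \<sigma>) \<bullet> X n w)) \<partial>N n)"
      using i int ball_exp_to_ball
      by (intro integral_mono) (auto simp: G_def hT simp del: of_nat_Suc)
    also have "\<dots> = 2 / real (Suc m) * (\<Sum>\<sigma>\<in>signs. L n (l + \<sigma>))"
      using int by (simp add: L_eq)
    finally show ?thesis .
  qed
  have approx': "\<bar>L' l - integral\<^sup>L M (G m l)\<bar> \<le> 2 / real (Suc m) * (\<Sum>\<sigma>\<in>signs. L' (l + \<sigma>))" for m l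
  proof (rule LIMSEQ_le)
    have Lr: "(\<lambda>n. L (r n) l) \<longlonglongrightarrow> L' l" for l
      using LIMSEQ_subseq_LIMSEQ[OF L r] by (simp add: o_def)
    show "(\<lambda>n. \<bar>L (r n) l - integral\<^sup>L (\<mu> (r n)) (G m l)\<bar>) \<longlonglongrightarrow> \<bar>L' l - integral\<^sup>L M (G m l)\<bar>"
      by (intro tendsto_intros Lr conv)
    show "(\<lambda>n. 2 / real (Suc m) * (\<Sum>\<sigma>\<in>signs. L (r n) (l + \<sigma>)))
        \<longlonglongrightarrow> 2 / real (Suc m) * (\<Sum>\<sigma>\<in>signs. L' (l + \<sigma>))"
      by (intro tendsto_intros Lr) auto
  qed (use approx in blast)
  have lim: "(\<lambda>m. integral\<^sup>L M (G m l)) \<longlonglongrightarrow> L' l" for l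
  proof -
    let ?g = "\<lambda>m. 2 * (\<Sum>\<sigma>\<in>signs. L' (l + \<sigma>)) * inverse (real (Suc m))"
    have le: "norm (L' l - integral\<^sup>L M (G m l)) \<le> ?g m" for m
      using approx'[of l m] by (simp add: divide_inverse mult_ac del: of_nat_Suc)
    have "?g \<longlonglongrightarrow> 2 * (\<Sum>\<sigma>\<in>signs. L' (l + \<sigma>)) * 0"
      by (intro tendsto_intros LIMSEQ_inverse_real_of_nat)
    then have "?g \<longlonglongrightarrow> 0"
      by simp
    then have "(\<lambda>m. L' l - integral\<^sup>L M (G m l)) \<longlonglongrightarrow> 0"
      by (rule Lim_null_comparison[OF always_eventually[OF allI[OF le]]])
    from tendsto_diff[OF tendsto_const[of "L' l"] this] show ?thesis
      by simp
  qed
  \<comment> \<open>Outside the set where \<open>norm (h t) < 1\<close> the value of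
    \<open>\<xi>\<close> is meaningless; the indicator in \<open>mct\<close> excludes it until its
    complement is known to have full measure.\<close>
  define \<xi> where "\<xi> t = from_ball (h t)" for t
  have \<xi> [measurable]: "\<xi> \<in> borel_measurable borel"
    unfolding \<xi>_def by measurable
  have mct: "has_bochner_integral M (\<lambda>t. exp (l \<bullet> \<xi> t) * indicator {..<1} (norm (h t))) (L' l)" for l
  proof (rule has_bochner_integral_monotone_convergence[OF G_int _ _ lim])
    show "AE t in M. mono (\<lambda>m. G m l t)"
      by (auto simp: mono_def G_def intro: ball_exp_mono)
    show "AE t in M. (\<lambda>m. G m l t) \<longlonglongrightarrow> exp (l \<bullet> \<xi> t) * indicator {..<1} (norm (h t))"
      unfolding G_def \<xi>_def ball_exp_eq by (intro always_eventually allI tendsto_intros cutoff_tendsto)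
  qed measurable
  \<comment> \<open>At \<open>l = 0\<close> the limit identity says that \<open>h\<close> maps
    almost every \<open>t\<close> into the open ball: no mass escapes to infinity.\<close>
  have "L n 0 = 1" for n
    using L_eq[of n 0] prob_space.prob_space[OF prob[of n]] by simp
  then have "L' 0 = 1"
    using L[of 0] by (simp add: LIMSEQ_const_iff)
  moreover have "(\<integral>t. exp (0 \<bullet> \<xi> t) * indicator {..<1} (norm (h t)) \<partial>M) = M.prob {t. norm (h t) < 1}"
  proof -
    have "(\<lambda>t. exp (0 \<bullet> \<xi> t) * indicator {..<1} (norm (h t)) :: real) = indicator {t. norm (h t) < 1}"
      by (auto simp: indicator_def)
    moreover have "{t. norm (h t) < 1} \<in> sets borel" by measurable
    ultimately show ?thesis by simp
  qed
  ultimately have "M.prob {t. norm (h t) < 1} = 1"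
    using has_bochner_integral_integral_eq[OF mct[of 0]] by simp
  then have "AE t in M. t \<in> {t. norm (h t) < 1}"
    by (intro M.AE_prob_1)
  then have AE: "AE t in M. exp (l \<bullet> \<xi> t) * indicator {..<1} (norm (h t)) = exp (l \<bullet> \<xi> t)" for l
    by (auto elim!: eventually_mono)
  have "has_bochner_integral M (\<lambda>t. exp (l \<bullet> \<xi> t)) (L' l)" for l
    using mct[of l] by (subst (asm) has_bochner_integral_cong_AE[OF _ _ AE]) auto
  then have "has_exp_moments M \<xi> L'"
    by (auto simp: has_exp_moments_def has_bochner_integral_iff M.prob_space_axioms)
  then show ?thesis by blast
qed

section \<open>Octant-monotonic functions as limits of discrete exponential moments\<close>

text \<open>Bernstein's argument: if all derivatives are nonnegative, then \<open>D n t\<close> is at most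
  \<open>D n 1\<close> on the unit interval, and the \<open>n\<close>-th term of the expansion at \<open>1\<close> of \<open>D 0 3\<close>
  shows that \<open>D n 1 / fact n\<close> is at most \<open>D 0 3 / 2 ^ n\<close>.\<close>

lemma absolutely_monotonic_taylor_sums:
  fixes D :: "nat \<Rightarrow> real \<Rightarrow> real"
  assumes D: "\<And>m t. (D m has_real_derivative D (Suc m) t) (at t)"
    and nonneg: "\<And>m t. 0 \<le> D m t"
  shows "(\<lambda>m. D m 0 / fact m) sums D 0 1"
proof -
  have bound: "D n 1 / fact n \<le> D 0 3 * (1/2) ^ n" for n
  proof -
    have "((\<lambda>t. D m (1 + t)) has_real_derivative D (Suc m) (1 + t)) (at t)" for m t
      using DERIV_shift[of "D m" "D (Suc m) (1 + t)" t 1] D by (simp add: add.commute)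
    \<comment> \<open>\<open>Suc n\<close> terms are taken so that the \<open>n\<close>-th one
      stands in the sum and not in the remainder.\<close>
    then obtain t where "D 0 3 = (\<Sum>m<Suc n. D m 1 / fact m * 2 ^ m) + D (Suc n) (1 + t) / fact (Suc n) * 2 ^ Suc n"
      using Maclaurin_all_le[of "\<lambda>m t. D m (1 + t)" "\<lambda>t. D 0 (1 + t)" 2 "Suc n"] by auto
    moreover have "0 \<le> (\<Sum>m<n. D m 1 / fact m * 2 ^ m)" "0 \<le> D (Suc n) (1 + t) / fact (Suc n) * 2 ^ Suc n"
      using nonneg by (auto intro!: sum_nonneg simp del: fact_Suc power_Suc)
    ultimately have "D n 1 / fact n * 2 ^ n \<le> D 0 3"
      by simp
    then show ?thesis
      by (simp add: field_simps power_one_over)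
  qed
  have rem: "\<bar>D 0 1 - (\<Sum>m<n. D m 0 / fact m)\<bar> \<le> D 0 3 * (1/2) ^ n" for n
  proof -
    obtain t where t: "\<bar>t\<bar> \<le> 1" and eq: "D 0 1 = (\<Sum>m<n. D m 0 / fact m) + D n t / fact n"
      using Maclaurin_all_le[of D "D 0" 1 n] D by auto
    have "D n t \<le> D n 1"
    proof (rule DERIV_nonneg_imp_nondecreasing[where f = "D n"])
      show "\<exists>y. (D n has_real_derivative y) (at x) \<and> 0 \<le> y" for x
        using D nonneg by blast
    qed (use t in auto)
    then have "D n t / fact n \<le> D 0 3 * (1/2) ^ n"
      using bound[of n] by (meson divide_right_mono fact_ge_zero order_trans)
    then show ?thesis
      using eq nonneg[of n t] by simp
  qed
  have "(\<lambda>n. D 0 3 * (1/2) ^ n) \<longlonglongrightarrow> D 0 3 * 0"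
    by (intro tendsto_intros LIMSEQ_power_zero) simp
  then have lim: "(\<lambda>n. D 0 3 * (1/2) ^ n) \<longlonglongrightarrow> 0"
    by simp
  have "(\<lambda>n. D 0 1 - (\<Sum>m<n. D m 0 / fact m)) \<longlonglongrightarrow> 0"
    by (rule Lim_null_comparison[OF _ lim]) (simp add: rem)
  from tendsto_diff[OF tendsto_const[of "D 0 1"] this] show ?thesis
    by (simp add: sums_def)
qed

section \<open>Taylor series as sums over words\<close>

lemma finite_lists_length: "finite {js :: 'n::finite list. length js = m}"
  using finite_lists_length_eq[of "UNIV :: 'n set" m] by simp

lemma sum_lists_Suc:
  fixes f :: "'n::finite list \<Rightarrow> 'b::comm_monoid_add"
  shows "(\<Sum>js | length js = Suc m. f js) = (\<Sum>js | length js = m. \<Sum>j\<in>UNIV. f (j # js))"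
proof -
  have "bij_betw (\<lambda>(js, j). j # js) ({js :: 'n list. length js = m} \<times> UNIV) {js. length js = Suc m}"
    by (auto simp: bij_betw_def inj_on_def length_Suc_conv image_iff)
  from sum.reindex_bij_betw[OF this, of f, symmetric] show ?thesis
    by (simp add: sum.cartesian_product case_prod_unfold)
qed

text \<open>The \<open>m\<close>-th derivative along a line is written as a sum over all words of length \<open>m\<close> in
  the coordinates, which avoids multi-indices and multinomial coefficients.\<close>

lemma smooth_taylor_sums:
  fixes F :: "real^'n::finite \<Rightarrow> real"
  assumes F: "smooth F"
    and nonneg: "\<And>js y. 0 \<le> (\<Prod>j\<leftarrow>js. v $ j) * foldr partial js F y"
  shows "(\<lambda>m. \<Sum>js | length js = m. (\<Prod>j\<leftarrow>js. v $ j) * foldr partial js F a / fact m) sums F (a + v)"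
proof -
  define D where "D m t = (\<Sum>js | length js = m. (\<Prod>j\<leftarrow>js. v $ j) * foldr partial js F (a + t *\<^sub>R v))" for m t
  have "(D m has_real_derivative D (Suc m) t) (at t)" for m t
  proof -
    have "(D m has_real_derivative (\<Sum>js | length js = m. (\<Prod>j\<leftarrow>js. v $ j) *
        (\<Sum>j\<in>UNIV. v $ j * partial j (foldr partial js F) (a + t *\<^sub>R v)))) (at t)"
      unfolding D_def
      by (intro DERIV_sum DERIV_cmult has_real_derivative_partials smooth_differentiable smooth_foldr_partial F)
    \<comment> \<open>Each differentiation prepends a letter, so the words of length
      \<open>m\<close> yield all words of length \<open>Suc m\<close>.\<close>
    then show ?thesis
      by (simp add: D_def sum_lists_Suc sum_distrib_left mult_ac)
  qed
  moreover have "0 \<le> D m t" for m t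
    unfolding D_def by (intro sum_nonneg nonneg)
  ultimately have "(\<lambda>m. D m 0 / fact m) sums D 0 1"
    by (rule absolutely_monotonic_taylor_sums)
  then show ?thesis
    by (simp add: D_def sum_divide_distrib)
qed

text \<open>Splitting the words by length gives finite blocks, so a series of block sums, such as a
  Taylor series over words, becomes an integral for a counting measure.\<close>

lemma nn_integral_count_space_lists:
  fixes f :: "'a \<times> 'n::finite list \<Rightarrow> real"
  assumes S: "finite S" and f: "\<And>p. p \<in> S \<times> UNIV \<Longrightarrow> 0 \<le> f p"
    and s: "(\<lambda>m. \<Sum>p\<in>S \<times> {js. length js = m}. f p) sums s"
  shows "(\<integral>\<^sup>+p. ennreal (f p) \<partial>count_space (S \<times> UNIV)) = ennreal s"
proof -
  let ?A = "\<lambda>m. S \<times> {js :: 'n list. length js = m}"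
  have fin: "finite (?A m)" for m
    using S finite_lists_length by auto
  have "(\<integral>\<^sup>+p. ennreal (f p) \<partial>count_space (S \<times> UNIV))
      = (\<integral>\<^sup>+p. (\<Sum>m. ennreal (f p) * indicator (?A m) p) \<partial>count_space (S \<times> UNIV))"
  proof (rule nn_integral_cong)
    fix p :: "'a \<times> 'n list" assume "p \<in> space (count_space (S \<times> UNIV))"
    then have "(\<Sum>m. ennreal (f p) * indicator (?A m) p) = (\<Sum>m\<in>{length (snd p)}. ennreal (f p) * indicator (?A m) p)"
      by (intro suminf_finite) (auto simp: indicator_def)
    then show "ennreal (f p) = (\<Sum>m. ennreal (f p) * indicator (?A m) p)"
      using \<open>p \<in> space _\<close> by (auto simp: indicator_def)
  qed
  also have "\<dots> = (\<Sum>m. \<integral>\<^sup>+p. ennreal (f p) * indicator (?A m) p \<partial>count_space (S \<times> UNIV))"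
    by (rule nn_integral_suminf) simp
  also have "\<dots> = (\<Sum>m. ennreal (\<Sum>p\<in>?A m. f p))"
  proof (rule suminf_cong)
    fix m
    have "(\<integral>\<^sup>+p. ennreal (f p) * indicator (?A m) p \<partial>count_space (S \<times> UNIV))
        = (\<Sum>p\<in>?A m. ennreal (f p) * indicator (?A m) p)"
      by (rule nn_integral_count_space'[OF fin]) auto
    also have "\<dots> = (\<Sum>p\<in>?A m. ennreal (f p))"
      by (rule sum.cong) auto
    also have "\<dots> = ennreal (\<Sum>p\<in>?A m. f p)"
      using f by (intro sum_ennreal) auto
    finally show "(\<integral>\<^sup>+p. ennreal (f p) * indicator (?A m) p \<partial>count_space (S \<times> UNIV)) = ennreal (\<Sum>p\<in>?A m. f p)" .
  qed
  also have "\<dots> = ennreal s"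
    using f by (intro suminf_ennreal_eq s sum_nonneg) auto
  finally show ?thesis .
qed

definition grid_point :: "real \<Rightarrow> real^'n::finite \<Rightarrow> 'n list \<Rightarrow> real^'n" where
  "grid_point r \<epsilon> js = (\<Sum>j\<leftarrow>js. axis j (\<epsilon> $ j / r))"

lemma exp_inner_grid_point: "exp (l \<bullet> grid_point r \<epsilon> js) = (\<Prod>j\<leftarrow>js. exp (\<epsilon> $ j * l $ j / r))"
  by (induction js) (simp_all add: grid_point_def inner_add_right exp_add inner_axis mult.commute)

text \<open>The point reached from \<open>- r *\<^sub>R \<epsilon>\<close> by the displacement with
  coordinates \<open>r * \<epsilon> $ j * exp (\<epsilon> $ j * l $ j / r)\<close>, whose monomials
  carry the exponentials of grid points.\<close>

definition exp_shift :: "real \<Rightarrow> real^'n::finite \<Rightarrow> real^'n \<Rightarrow> real^'n" where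
  "exp_shift r \<epsilon> l = (\<chi> j. r * \<epsilon> $ j * (exp (\<epsilon> $ j * l $ j / r) - 1))"

text \<open>Each coordinate is \<open>\<epsilon> $ j\<close> times a difference quotient at 0 of
  \<open>exp (?c * h)\<close>, and the square of \<open>\<epsilon> $ j\<close> is 1.\<close>

lemma exp_shift_tendsto:
  assumes "\<epsilon> \<in> signs"
  shows "(\<lambda>n. exp_shift (real (Suc n)) \<epsilon> l) \<longlonglongrightarrow> l"
proof (rule vec_tendstoI)
  fix j
  let ?c = "\<epsilon> $ j * l $ j"
  have "((\<lambda>h. exp (?c * h)) has_real_derivative ?c) (at 0)"
    by (auto intro!: derivative_eq_intros)
  then have "((\<lambda>h. (exp (?c * h) - 1) / h) \<longlongrightarrow> ?c) (at 0)"
    by (simp add: DERIV_def)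
  moreover have "filterlim (\<lambda>n. inverse (real (Suc n))) (at 0) sequentially"
    unfolding filterlim_at using LIMSEQ_inverse_real_of_nat by (auto intro!: always_eventually)
  ultimately have "(\<lambda>n. (exp (?c * inverse (real (Suc n))) - 1) / inverse (real (Suc n))) \<longlonglongrightarrow> ?c"
    by (rule filterlim_compose)
  then have "(\<lambda>n. \<epsilon> $ j * ((exp (?c * inverse (real (Suc n))) - 1) / inverse (real (Suc n)))) \<longlonglongrightarrow> \<epsilon> $ j * ?c"
    by (intro tendsto_intros)
  moreover have "\<epsilon> $ j = - 1 \<or> \<epsilon> $ j = 1"
    using assms by (simp add: signs_def)
  then have "\<epsilon> $ j * ?c = l $ j"
    by auto
  ultimately show "(\<lambda>n. exp_shift (real (Suc n)) \<epsilon> l $ j) \<longlonglongrightarrow> l $ j"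
    by (simp add: exp_shift_def divide_inverse mult_ac del: of_nat_Suc)
qed

text \<open>Feller's discretisation: as a function of the numbers \<open>exp (\<epsilon> $ j * l $ j / r)\<close>, the value
  \<open>F \<epsilon> (exp_shift r \<epsilon> l)\<close> is a power series with nonnegative coefficients, that is, the
  exponential moment function of a discrete measure on a grid of mesh \<open>1 / r\<close>.\<close>

lemma discrete_exp_moments:
  fixes F :: "real^'n::finite \<Rightarrow> real^'n \<Rightarrow> real"
  assumes F: "\<And>\<epsilon>. \<epsilon> \<in> signs \<Longrightarrow> F \<epsilon> \<in> octant_monotonic \<epsilon>"
    and one: "(\<Sum>\<epsilon>\<in>signs. F \<epsilon> 0) = 1" and r: "r > 0"
  shows "\<exists>N. has_exp_moments (N :: ((real^'n) \<times> 'n list) measure) (\<lambda>(\<epsilon>, js). grid_point r \<epsilon> js)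
    (\<lambda>l. \<Sum>\<epsilon>\<in>signs. F \<epsilon> (exp_shift r \<epsilon> l))"
proof -
  \<comment> \<open>The Taylor coefficient of \<open>F \<epsilon>\<close> at
    \<open>- r *\<^sub>R \<epsilon>\<close>, including the factors \<open>r * \<epsilon> $ j\<close>
    of the displacement but not its exponential factors.\<close>
  define w where "w = (\<lambda>(\<epsilon>, js). r ^ length js * (\<Prod>j\<leftarrow>js. \<epsilon> $ j) * foldr partial js (F \<epsilon>) (- r *\<^sub>R \<epsilon>) / fact (length js))"
  define A where "A = (signs :: (real^'n) set) \<times> (UNIV :: 'n list set)"
  define N where "N = density (count_space A) (\<lambda>p. ennreal (w p))"
  define X where "X = (\<lambda>(\<epsilon>, js). grid_point r \<epsilon> js :: real^'n)"
  define L where "L l = (\<Sum>\<epsilon>\<in>signs. F \<epsilon> (exp_shift r \<epsilon> l))" for l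
  have w_nonneg: "0 \<le> w p" if pA: "p \<in> A" for p
  proof -
    obtain \<epsilon> js where p: "p = (\<epsilon>, js)" and "\<epsilon> \<in> signs"
      using pA by (auto simp: A_def)
    from octant_monotonic_sign[OF F[OF this(2)], of js "- r *\<^sub>R \<epsilon>"] r show ?thesis
      unfolding p w_def prod.case mult.assoc
      by (intro divide_nonneg_nonneg mult_nonneg_nonneg[of "r ^ length js"]) auto
  qed
  have L_nonneg: "0 \<le> L l" for l
    unfolding L_def using octant_monotonic_sign[OF F, of _ "[]"] by (auto intro!: sum_nonneg)
  have sums: "(\<lambda>m. \<Sum>p\<in>signs \<times> {js. length js = m}. w p * exp (l \<bullet> X p)) sums L l" for l
  proof -
    have "(\<lambda>m. \<Sum>js | length js = m. w (\<epsilon>, js) * exp (l \<bullet> X (\<epsilon>, js))) sums F \<epsilon> (exp_shift r \<epsilon> l)"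
      if \<epsilon>: "\<epsilon> \<in> signs" for \<epsilon>
    proof -
      define v where "v = (\<chi> j. r * \<epsilon> $ j * exp (\<epsilon> $ j * l $ j / r))"
      \<comment> \<open>The exponential factors multiply to the exponential at the grid point of the
        word, so the Taylor terms have the form weight times exponential.\<close>
      have prod_v: "(\<Prod>j\<leftarrow>js. v $ j) = r ^ length js * (\<Prod>j\<leftarrow>js. \<epsilon> $ j) * exp (l \<bullet> X (\<epsilon>, js))" for js
        unfolding X_def prod.case exp_inner_grid_point by (induction js) (simp_all add: v_def mult_ac)
      have "(\<lambda>m. \<Sum>js | length js = m. (\<Prod>j\<leftarrow>js. v $ j) * foldr partial js (F \<epsilon>) (- r *\<^sub>R \<epsilon>) / fact m)
          sums F \<epsilon> (- r *\<^sub>R \<epsilon> + v)"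
      proof (rule smooth_taylor_sums)
        show "smooth (F \<epsilon>)"
          using F[OF \<epsilon>] by (simp add: octant_monotonic_def)
        fix js y
        have "0 \<le> (r ^ length js * exp (l \<bullet> X (\<epsilon>, js))) * ((\<Prod>j\<leftarrow>js. \<epsilon> $ j) * foldr partial js (F \<epsilon>) y)"
          using r by (intro mult_nonneg_nonneg octant_monotonic_sign[OF F[OF \<epsilon>]]) auto
        then show "0 \<le> (\<Prod>j\<leftarrow>js. v $ j) * foldr partial js (F \<epsilon>) y"
          by (simp only: prod_v mult_ac)
      qed
      moreover have "- r *\<^sub>R \<epsilon> + v = exp_shift r \<epsilon> l"
        by (simp add: vec_eq_iff v_def exp_shift_def algebra_simps)
      moreover have "(\<Sum>js | length js = m. w (\<epsilon>, js) * exp (l \<bullet> X (\<epsilon>, js)))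
          = (\<Sum>js | length js = m. (\<Prod>j\<leftarrow>js. v $ j) * foldr partial js (F \<epsilon>) (- r *\<^sub>R \<epsilon>) / fact m)" for m
        by (rule sum.cong) (simp_all add: prod_v w_def)
      ultimately show ?thesis
        by simp
    qed
    then have "(\<lambda>m. \<Sum>\<epsilon>\<in>signs. \<Sum>js | length js = m. w (\<epsilon>, js) * exp (l \<bullet> X (\<epsilon>, js))) sums L l"
      unfolding L_def by (rule sums_sum)
    moreover have "(\<Sum>\<epsilon>\<in>signs. \<Sum>js | length js = m. w (\<epsilon>, js) * exp (l \<bullet> X (\<epsilon>, js)))
        = (\<Sum>p\<in>signs \<times> {js. length js = m}. w p * exp (l \<bullet> X p))" for m
      by (subst sum.cartesian_product) (rule sum.cong, auto)
    ultimately show ?thesis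
      by (simp only:)
  qed
  have nn: "(\<integral>\<^sup>+p. ennreal (exp (l \<bullet> X p)) \<partial>N) = ennreal (L l)" for l
  proof -
    have "(\<integral>\<^sup>+p. ennreal (exp (l \<bullet> X p)) \<partial>N) = (\<integral>\<^sup>+p. ennreal (w p * exp (l \<bullet> X p)) \<partial>count_space A)"
      unfolding N_def by (subst nn_integral_density) (auto simp: ennreal_mult' w_nonneg intro!: nn_integral_cong)
    also have "\<dots> = ennreal (L l)"
      unfolding A_def using w_nonneg
      by (intro nn_integral_count_space_lists finite_signs sums) (auto simp: A_def)
    finally show ?thesis .
  qed
  have X: "X \<in> borel_measurable N"
    by (simp add: N_def)
  \<comment> \<open>\<open>exp_shift r \<epsilon> 0\<close> is 0, so the total mass is the sum of
    the \<open>F \<epsilon> 0\<close>.\<close>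
  have "emeasure N (space N) = 1"
    using nn[of 0] one by (simp add: L_def exp_shift_def zero_vec_def[symmetric])
  then have "prob_space N"
    by (rule prob_spaceI)
  moreover have "has_bochner_integral N (\<lambda>p. exp (l \<bullet> X p)) (L l)" for l
    using X by (intro has_bochner_integral_nn_integral nn L_nonneg) auto
  ultimately have "has_exp_moments N X L"
    using X by (auto simp: has_exp_moments_def has_bochner_integral_iff)
  then show ?thesis
    unfolding X_def L_def by (rule exI)
qed

section \<open>Differentiation of exponential moments\<close>

text \<open>Divided by \<open>norm h\<close>, a quadratic remainder still tends to 0. This reduces
  differentiation under the integral to one explicit estimate.\<close>

lemma has_derivative_quadratic:
  fixes f :: "'a::real_normed_vector \<Rightarrow> 'b::real_normed_vector"
  assumes D: "bounded_linear D"
    and bound: "\<And>h. norm h \<le> 1 \<Longrightarrow> norm (f (x + h) - f x - D h) \<le> C * (norm h)\<^sup>2"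
  shows "(f has_derivative D) (at x)"
  unfolding has_derivative_at
proof
  have "((\<lambda>h::'a. C * norm h) \<longlongrightarrow> C * 0) (at 0)"
    by (intro tendsto_mult tendsto_const tendsto_norm_zero tendsto_ident_at)
  then have lim: "((\<lambda>h::'a. C * norm h) \<longlongrightarrow> 0) (at 0)"
    by simp
  have "\<forall>\<^sub>F h in at 0. norm (norm (f (x + h) - f x - D h) / norm h) \<le> C * norm h"
    unfolding eventually_at
  proof (intro exI[of _ 1] conjI ballI impI)
    fix h :: 'a assume "h \<noteq> 0 \<and> dist h 0 < 1"
    then show "norm (norm (f (x + h) - f x - D h) / norm h) \<le> C * norm h"
      using bound[of h] by (simp add: field_simps power2_eq_square)
  qed simp
  then show "((\<lambda>h. norm (f (x + h) - f x - D h) / norm h) \<longlongrightarrow> 0) (at 0)"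
    by (rule Lim_null_comparison) (rule lim)
qed (rule D)

text \<open>The Lagrange remainder is \<open>exp a * (exp t / 2 * b\<^sup>2)\<close> with
  \<open>t\<close> between \<open>- \<bar>b\<bar>\<close> and \<open>\<bar>b\<bar>\<close>.\<close>

lemma exp_first_order_bound: "\<bar>exp (a + b) - exp a - b * exp a\<bar> \<le> b\<^sup>2 * exp (a + \<bar>b\<bar>)" for a b :: real
proof -
  obtain t where t: "\<bar>t\<bar> \<le> \<bar>b\<bar>" "exp b = (\<Sum>m<2. b ^ m / fact m) + exp t / fact 2 * b ^ 2"
    using Maclaurin_exp_le[of b 2] by blast
  then have "exp (a + b) - exp a - b * exp a = exp a * (exp t / 2 * b\<^sup>2)"
    by (simp add: exp_add numeral_2_eq_2 algebra_simps)
  moreover have "0 \<le> exp a * (exp t / 2 * b\<^sup>2)"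
    by simp
  ultimately have "\<bar>exp (a + b) - exp a - b * exp a\<bar> = exp a * (exp t / 2 * b\<^sup>2)"
    by (simp only: abs_of_nonneg)
  moreover have "exp t / 2 \<le> exp \<bar>b\<bar>"
  proof -
    have "exp t \<le> exp \<bar>b\<bar>" "0 \<le> exp \<bar>b\<bar>"
      using t(1) by auto
    then show ?thesis by linarith
  qed
  then have "exp a * (exp t / 2 * b\<^sup>2) \<le> exp a * (exp \<bar>b\<bar> * b\<^sup>2)"
    by (intro mult_left_mono mult_right_mono) auto
  moreover have "exp a * (exp \<bar>b\<bar> * b\<^sup>2) = b\<^sup>2 * exp (a + \<bar>b\<bar>)"
    by (simp add: exp_add)
  ultimately show ?thesis
    by linarith
qed

section \<open>Exponential moments weighted by monomials\<close>

definition monomial :: "'n list \<Rightarrow> real^'n::finite \<Rightarrow> real" where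
  "monomial js x = (\<Prod>j\<leftarrow>js. x $ j)"

lemma abs_monomial_le: "\<bar>monomial js x\<bar> \<le> exp (real (length js) * norm x)"
proof (induction js)
  case (Cons j js)
  have "\<bar>x $ j\<bar> \<le> exp (norm x)"
    using component_le_norm_cart[of x j] exp_ge_add_one_self[of "norm x"] by linarith
  then have "\<bar>x $ j\<bar> * \<bar>monomial js x\<bar> \<le> exp (norm x) * exp (real (length js) * norm x)"
    using Cons by (intro mult_mono) auto
  then show ?case
    by (simp add: monomial_def abs_mult exp_add distrib_right)
qed (simp add: monomial_def)

lemma borel_measurable_monomial [measurable]: "monomial js \<in> borel_measurable borel"
proof (induction js)
  case (Cons j js)
  have "monomial (j # js) = (\<lambda>x. x $ j * monomial js x)"
    by (simp add: monomial_def fun_eq_iff)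
  then show ?case
    using Cons by simp
qed (simp add: monomial_def[abs_def])

lemma integrable_exp_norm:
  fixes \<xi> :: "'w \<Rightarrow> real^'n::finite"
  assumes [measurable]: "\<xi> \<in> borel_measurable M"
    and int: "\<And>l. integrable M (\<lambda>w. exp (l \<bullet> \<xi> w))" and k: "0 \<le> k"
  shows "integrable M (\<lambda>w. exp (l \<bullet> \<xi> w + k * norm (\<xi> w)))"
proof (rule Bochner_Integration.integrable_bound)
  show "integrable M (\<lambda>w. \<Sum>\<sigma>\<in>signs. exp ((l + k *\<^sub>R \<sigma>) \<bullet> \<xi> w))"
    by (intro Bochner_Integration.integrable_sum int)
  show "AE w in M. norm (exp (l \<bullet> \<xi> w + k * norm (\<xi> w))) \<le> norm (\<Sum>\<sigma>\<in>signs. exp ((l + k *\<^sub>R \<sigma>) \<bullet> \<xi> w))"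
    using exp_norm_le_sum_signs[OF k, of l] by (auto intro!: always_eventually order_trans[OF _ abs_ge_self])
qed measurable

text \<open>Differentiation under the integral: the first-order remainder is at most
  \<open>(norm h)\<^sup>2\<close> times an integrable function, and \<open>partial j\<close> brings
  down a factor \<open>\<xi> w $ j\<close>, which prepends \<open>j\<close> to the word. The weight
  \<open>g\<close> will select an octant.\<close>

lemma
  fixes \<xi> :: "'w \<Rightarrow> real^'n::finite"
  assumes [measurable]: "\<xi> \<in> borel_measurable M" "g \<in> borel_measurable M"
    and int: "\<And>l. integrable M (\<lambda>w. exp (l \<bullet> \<xi> w))"
    and g: "\<And>w. \<bar>g w\<bar> \<le> 1"
  defines "H \<equiv> \<lambda>js l. \<integral>w. monomial js (\<xi> w) * g w * exp (l \<bullet> \<xi> w) \<partial>M"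
  shows foldr_partial_exp_moment: "foldr partial js (H []) = H js"
    and smooth_exp_moment: "smooth (H [])"
proof -
  have mg: "\<bar>monomial js (\<xi> w) * g w\<bar> \<le> exp (real (length js) * norm (\<xi> w))" for js w
    using mult_mono[OF abs_monomial_le[of js "\<xi> w"] g[of w]] by (simp add: abs_mult)
  have int': "integrable M (\<lambda>w. monomial js (\<xi> w) * g w * exp (l \<bullet> \<xi> w))" for js l
  proof (rule Bochner_Integration.integrable_bound)
    show "integrable M (\<lambda>w. exp (l \<bullet> \<xi> w + real (length js) * norm (\<xi> w)))"
      by (intro integrable_exp_norm int) auto
    show "AE w in M. norm (monomial js (\<xi> w) * g w * exp (l \<bullet> \<xi> w))
        \<le> norm (exp (l \<bullet> \<xi> w + real (length js) * norm (\<xi> w)))"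
      using mg[of js] by (intro always_eventually allI) (simp add: abs_mult exp_add mult.commute)
  qed measurable
  have deriv: "(H js has_derivative (\<lambda>h. \<Sum>j\<in>UNIV. h $ j * H (j # js) l)) (at l)" for js l
  proof (rule has_derivative_quadratic)
    show "bounded_linear (\<lambda>h. \<Sum>j\<in>UNIV. h $ j * H (j # js) l)"
      by (intro bounded_linear_sum bounded_linear_compose[OF bounded_linear_mult_left] bounded_linear_vec_nth)
    fix h :: "real^'n" assume h: "norm h \<le> 1"
    let ?m = "\<lambda>w. monomial js (\<xi> w) * g w"
    let ?r = "\<lambda>w. exp ((l + h) \<bullet> \<xi> w) - exp (l \<bullet> \<xi> w) - h \<bullet> \<xi> w * exp (l \<bullet> \<xi> w)"
    \<comment> \<open>In the exponent, \<open>length js\<close> pays for the monomial, 2 for the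
      square of \<open>h \<bullet> \<xi> w\<close>, and 1 for the exponential in the remainder
      bound.\<close>
    let ?k = "real (length js) + 3"
    have mon: "(\<Sum>j\<in>UNIV. h $ j * (monomial (j # js) x * b)) = h \<bullet> x * (monomial js x * b)" for x b
      by (simp add: monomial_def inner_vec_def sum_distrib_left sum_distrib_right mult_ac)
    have int_lin: "integrable M (\<lambda>w. h \<bullet> \<xi> w * (?m w * exp (l \<bullet> \<xi> w)))"
    proof -
      have "integrable M (\<lambda>w. \<Sum>j\<in>UNIV. h $ j * (monomial (j # js) (\<xi> w) * g w * exp (l \<bullet> \<xi> w)))"
        by (intro Bochner_Integration.integrable_sum integrable_mult_right int')
      then show ?thesis
        by (simp only: mon mult.assoc)
    qed
    have "(\<Sum>j\<in>UNIV. h $ j * H (j # js) l) = (\<integral>w. h \<bullet> \<xi> w * (?m w * exp (l \<bullet> \<xi> w)) \<partial>M)"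
    proof -
      have "(\<Sum>j\<in>UNIV. h $ j * H (j # js) l)
          = (\<integral>w. (\<Sum>j\<in>UNIV. h $ j * (monomial (j # js) (\<xi> w) * g w * exp (l \<bullet> \<xi> w))) \<partial>M)"
        by (simp only: H_def Bochner_Integration.integral_sum integrable_mult_right int' integral_mult_right_zero)
      then show ?thesis
        by (simp only: mon mult.assoc)
    qed
    then have "H js (l + h) - H js l - (\<Sum>j\<in>UNIV. h $ j * H (j # js) l)
        = (\<integral>w. ?m w * exp ((l + h) \<bullet> \<xi> w) - ?m w * exp (l \<bullet> \<xi> w) - h \<bullet> \<xi> w * (?m w * exp (l \<bullet> \<xi> w)) \<partial>M)"
      unfolding H_def by (simp only: Bochner_Integration.integral_diff Bochner_Integration.integrable_diff int' int_lin)
    also have "norm \<dots> \<le> (\<integral>w. (norm h)\<^sup>2 * exp (l \<bullet> \<xi> w + ?k * norm (\<xi> w)) \<partial>M)"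
    proof (rule order_trans[OF integral_norm_bound integral_mono])
      show "integrable M (\<lambda>w. (norm h)\<^sup>2 * exp (l \<bullet> \<xi> w + ?k * norm (\<xi> w)))"
        by (intro integrable_mult_right integrable_exp_norm int) auto
      show "integrable M (\<lambda>w. norm (?m w * exp ((l + h) \<bullet> \<xi> w) - ?m w * exp (l \<bullet> \<xi> w) - h \<bullet> \<xi> w * (?m w * exp (l \<bullet> \<xi> w))))"
        by (intro integrable_norm Bochner_Integration.integrable_diff int' int_lin)
      fix w
      let ?x = "\<xi> w"
      have hx: "\<bar>h \<bullet> ?x\<bar> \<le> norm h * norm ?x"
        by (rule Cauchy_Schwarz_ineq2)
      have hx1: "\<bar>h \<bullet> ?x\<bar> \<le> norm ?x"
        using hx mult_right_mono[OF h norm_ge_zero, of ?x] by simp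
      have "norm ?x \<le> exp (norm ?x)"
        using exp_ge_add_one_self[of "norm ?x"] by linarith
      then have "norm h * norm ?x \<le> norm h * exp (norm ?x)"
        by (rule mult_left_mono) simp
      with hx have "(h \<bullet> ?x)\<^sup>2 \<le> (norm h * exp (norm ?x))\<^sup>2"
        by (intro abs_le_square_iff[THEN iffD1]) (simp add: abs_mult)
      then have sq: "(h \<bullet> ?x)\<^sup>2 \<le> (norm h)\<^sup>2 * exp (2 * norm ?x)"
        by (simp add: power_mult_distrib exp_double)
      have "\<bar>?r w\<bar> \<le> (h \<bullet> ?x)\<^sup>2 * exp (l \<bullet> ?x + \<bar>h \<bullet> ?x\<bar>)"
        using exp_first_order_bound[of "l \<bullet> ?x" "h \<bullet> ?x"] by (simp add: inner_add_left)
      also have "\<dots> \<le> (norm h)\<^sup>2 * exp (2 * norm ?x) * exp (l \<bullet> ?x + norm ?x)"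
        using sq hx1 by (intro mult_mono) auto
      finally have "\<bar>?m w\<bar> * \<bar>?r w\<bar> \<le> exp (real (length js) * norm ?x) * ((norm h)\<^sup>2 * exp (2 * norm ?x) * exp (l \<bullet> ?x + norm ?x))"
        by (intro mult_mono mg) auto
      also have "\<dots> = (norm h)\<^sup>2 * exp (l \<bullet> ?x + ?k * norm ?x)"
        by (simp add: exp_add[symmetric] algebra_simps)
      finally have "\<bar>?m w * ?r w\<bar> \<le> (norm h)\<^sup>2 * exp (l \<bullet> ?x + ?k * norm ?x)"
        by (simp only: abs_mult)
      moreover have "?m w * exp ((l + h) \<bullet> ?x) - ?m w * exp (l \<bullet> ?x) - h \<bullet> ?x * (?m w * exp (l \<bullet> ?x)) = ?m w * ?r w"
        by (simp add: algebra_simps)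
      ultimately show "norm (?m w * exp ((l + h) \<bullet> ?x) - ?m w * exp (l \<bullet> ?x) - h \<bullet> ?x * (?m w * exp (l \<bullet> ?x)))
          \<le> (norm h)\<^sup>2 * exp (l \<bullet> ?x + ?k * norm ?x)"
        by (simp only: real_norm_def)
    qed
    finally show "norm (H js (l + h) - H js l - (\<Sum>j\<in>UNIV. h $ j * H (j # js) l))
        \<le> (\<integral>w. exp (l \<bullet> \<xi> w + ?k * norm (\<xi> w)) \<partial>M) * (norm h)\<^sup>2"
      by (simp add: mult.commute)
  qed
  have "partial j (H js) = H (j # js)" for j js
  proof
    fix l
    show "partial j (H js) l = H (j # js) l"
      by (simp add: partial_eq_derivative[OF deriv] axis_def if_distrib[of "\<lambda>x. x * _"] cong: if_cong)
  qed
  then show *: "foldr partial js (H []) = H js" for js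
    by (induction js) auto
  show "smooth (H [])"
    unfolding smooth_def * using deriv by (auto simp: differentiable_def)
qed

text \<open>Zero coordinates count as positive, so each point is assigned to exactly one octant
  although the octants overlap on their boundaries.\<close>

definition sign_vec :: "real^'n::finite \<Rightarrow> real^'n" where
  "sign_vec x = (\<chi> j. if 0 \<le> x $ j then 1 else -1)"

lemma sign_vec_in_signs: "sign_vec x \<in> signs"
  by (simp add: sign_vec_def signs_def)

lemma borel_measurable_sign_vec_eq [measurable]:
  "(\<lambda>x. of_bool (sign_vec x = \<epsilon>) :: real) \<in> borel_measurable borel"
proof -
  have "(\<lambda>x. of_bool (sign_vec x = \<epsilon>) :: real)
      = (\<lambda>x. \<Prod>j\<in>UNIV. if sign_vec x $ j = \<epsilon> $ j then 1 else 0)"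
  proof
    fix x
    show "of_bool (sign_vec x = \<epsilon>) = (\<Prod>j\<in>UNIV. if sign_vec x $ j = \<epsilon> $ j then 1 else 0 :: real)"
    proof (cases "sign_vec x = \<epsilon>")
      case False
      then obtain j where "sign_vec x $ j \<noteq> \<epsilon> $ j"
        by (auto simp: vec_eq_iff)
      then have "(\<Prod>j\<in>UNIV. if sign_vec x $ j = \<epsilon> $ j then 1 else 0 :: real) = 0"
        by (intro prod_zero) auto
      with False show ?thesis
        by simp
    qed simp
  qed
  also have "\<dots> \<in> borel_measurable borel"
    unfolding sign_vec_def vec_lambda_beta by measurable
  finally show ?thesis .
qed

text \<open>Multiplied by its sign, each coordinate becomes its absolute value.\<close>

lemma monomial_multi_list_sign: "0 \<le> multi_power (sign_vec x) k * monomial (multi_list k) x"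
proof -
  have "multi_power (sign_vec x) k * monomial (multi_list k) x = (\<Prod>j\<in>UNIV. (sign_vec x $ j * x $ j) ^ k j)"
    by (simp add: multi_power_def monomial_def prod_list_multi_list power_mult_distrib prod.distrib)
  also have "\<dots> \<ge> 0"
    by (intro prod_nonneg) (auto simp: sign_vec_def)
  finally show ?thesis .
qed

lemma multi_power_cases:
  assumes "\<epsilon> \<in> signs"
  shows "multi_power \<epsilon> k = 1 \<or> multi_power \<epsilon> k = -1"
proof -
  from assms have "\<epsilon> $ j = - 1 \<or> \<epsilon> $ j = 1" for j
    by (simp add: signs_def)
  then have "\<bar>\<epsilon> $ j\<bar> = 1" for j
    by (metis abs_minus_cancel abs_one)
  then have "\<bar>multi_power \<epsilon> k\<bar> = 1"
    by (simp add: multi_power_def abs_prod power_abs)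
  then show ?thesis by linarith
qed

text \<open>A derivative is the integral of a monomial against a nonnegative weight that vanishes
  unless \<open>sign_vec (\<xi> w)\<close> is \<epsilon>, and there the monomial is 0 or has the
  sign \<open>multi_power \<epsilon> k\<close>.\<close>

lemma exp_moments_octant_monotonic:
  fixes \<xi> :: "'w \<Rightarrow> real^'n::finite"
  assumes [measurable]: "\<xi> \<in> borel_measurable M"
    and int: "\<And>l. integrable M (\<lambda>w. exp (l \<bullet> \<xi> w))" and \<epsilon>: "\<epsilon> \<in> signs"
  shows "(\<lambda>l. \<integral>w. of_bool (sign_vec (\<xi> w) = \<epsilon>) * exp (l \<bullet> \<xi> w) \<partial>M) \<in> octant_monotonic \<epsilon>"
proof -
  let ?g = "\<lambda>w. of_bool (sign_vec (\<xi> w) = \<epsilon>) :: real"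
  let ?H = "\<lambda>js l. \<integral>w. monomial js (\<xi> w) * ?g w * exp (l \<bullet> \<xi> w) \<partial>M"
  have g [measurable]: "?g \<in> borel_measurable M"
    by (rule measurable_compose[OF assms(1) borel_measurable_sign_vec_eq])
  have g1: "\<bar>?g w\<bar> \<le> 1" for w
    by simp
  have "sgn (multi_partial k (?H []) l) \<in> {0, multi_power \<epsilon> k}" for k l
  proof -
    have "multi_partial k (?H []) l = ?H (multi_list k) l"
      unfolding multi_partial_eq_foldr foldr_partial_exp_moment[OF assms(1) g int g1] ..
    moreover have "0 \<le> multi_power \<epsilon> k * ?H (multi_list k) l"
    proof -
      have "0 \<le> (\<integral>w. multi_power \<epsilon> k * (monomial (multi_list k) (\<xi> w) * ?g w * exp (l \<bullet> \<xi> w)) \<partial>M)"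
      proof (rule Bochner_Integration.integral_nonneg)
        show "0 \<le> multi_power \<epsilon> k * (monomial (multi_list k) (\<xi> w) * ?g w * exp (l \<bullet> \<xi> w))" for w
          using monomial_multi_list_sign[of "\<xi> w" k]
          by (cases "sign_vec (\<xi> w) = \<epsilon>") (simp_all flip: mult.assoc)
      qed
      then show ?thesis by simp
    qed
    ultimately show ?thesis
      using multi_power_cases[OF \<epsilon>, of k] by (auto simp: sgn_if)
  qed
  then have "?H [] \<in> octant_monotonic \<epsilon>"
    using smooth_exp_moment[OF assms(1) g int g1] by (simp add: octant_monotonic_def)
  then show ?thesis
    by (simp add: monomial_def)
qed

theorem theorem4p1:
  fixes \<phi> :: "real^'n::finite \<Rightarrow> real"
  assumes "CARD('n) \<ge> 2"
    and "smooth \<phi>"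
    and "\<phi> 0 = 0"
  shows "(\<exists>(M :: (real^'n) measure) (\<xi> :: real^'n \<Rightarrow> real^'n).
            has_exp_moments M \<xi> (\<lambda>l. exp (\<phi> l)))
    \<longleftrightarrow> (\<exists>F :: real^'n \<Rightarrow> real^'n \<Rightarrow> real.
            (\<forall>\<epsilon>\<in>signs. F \<epsilon> \<in> octant_monotonic \<epsilon>)
          \<and> (\<forall>l. exp (\<phi> l) = (\<Sum>\<epsilon>\<in>signs. F \<epsilon> l))
          \<and> (\<Sum>\<epsilon>\<in>signs. F \<epsilon> 0) = 1)"
proof (intro iffI; elim exE)
  fix M :: "(real^'n) measure" and \<xi> :: "real^'n \<Rightarrow> real^'n"
  assume "has_exp_moments M \<xi> (\<lambda>l. exp (\<phi> l))"
  then have \<xi> [measurable]: "\<xi> \<in> borel_measurable M"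
    and int: "integrable M (\<lambda>w. exp (l \<bullet> \<xi> w))"
    and moment: "(\<integral>w. exp (l \<bullet> \<xi> w) \<partial>M) = exp (\<phi> l)" for l
    by (auto simp: has_exp_moments_def)
  define F where "F \<epsilon> l = (\<integral>w. of_bool (sign_vec (\<xi> w) = \<epsilon>) * exp (l \<bullet> \<xi> w) \<partial>M)" for \<epsilon> l
  have sum_F: "exp (\<phi> l) = (\<Sum>\<epsilon>\<in>signs. F \<epsilon> l)" for l
  proof -
    have int_F: "integrable M (\<lambda>w. of_bool (sign_vec (\<xi> w) = \<epsilon>) * exp (l \<bullet> \<xi> w))" for \<epsilon>
      by (rule Bochner_Integration.integrable_bound[OF int[of l]])
        (auto intro: borel_measurable_times measurable_compose[OF \<xi> borel_measurable_sign_vec_eq])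
    have "(\<Sum>\<epsilon>\<in>signs. of_bool (sign_vec x = \<epsilon>) * exp (l \<bullet> x)) = exp (l \<bullet> x)" for x :: "real^'n"
      using sign_vec_in_signs[of x] by (simp add: of_bool_def finite_signs flip: sum_distrib_right)
    then have "exp (\<phi> l) = (\<integral>w. (\<Sum>\<epsilon>\<in>signs. of_bool (sign_vec (\<xi> w) = \<epsilon>) * exp (l \<bullet> \<xi> w)) \<partial>M)"
      by (simp add: moment)
    also have "\<dots> = (\<Sum>\<epsilon>\<in>signs. F \<epsilon> l)"
      unfolding F_def by (rule Bochner_Integration.integral_sum) (rule int_F)
    finally show ?thesis .
  qed
  moreover have "\<forall>\<epsilon>\<in>signs. F \<epsilon> \<in> octant_monotonic \<epsilon>"
    unfolding F_def using exp_moments_octant_monotonic[OF \<xi> int] by blast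
  moreover have "(\<Sum>\<epsilon>\<in>signs. F \<epsilon> 0) = 1"
    using sum_F[of 0] assms(3) by simp
  ultimately show "\<exists>F :: real^'n \<Rightarrow> real^'n \<Rightarrow> real. (\<forall>\<epsilon>\<in>signs. F \<epsilon> \<in> octant_monotonic \<epsilon>)
      \<and> (\<forall>l. exp (\<phi> l) = (\<Sum>\<epsilon>\<in>signs. F \<epsilon> l)) \<and> (\<Sum>\<epsilon>\<in>signs. F \<epsilon> 0) = 1"
    by blast
next
  fix F :: "real^'n \<Rightarrow> real^'n \<Rightarrow> real"
  assume "(\<forall>\<epsilon>\<in>signs. F \<epsilon> \<in> octant_monotonic \<epsilon>)
      \<and> (\<forall>l. exp (\<phi> l) = (\<Sum>\<epsilon>\<in>signs. F \<epsilon> l)) \<and> (\<Sum>\<epsilon>\<in>signs. F \<epsilon> 0) = 1"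
  then have F: "\<And>\<epsilon>. \<epsilon> \<in> signs \<Longrightarrow> F \<epsilon> \<in> octant_monotonic \<epsilon>"
    and sum_F: "\<And>l. exp (\<phi> l) = (\<Sum>\<epsilon>\<in>signs. F \<epsilon> l)" and one: "(\<Sum>\<epsilon>\<in>signs. F \<epsilon> 0) = 1"
    by auto
  \<comment> \<open>The grid has mesh \<open>1 / real (Suc n)\<close>; \<open>Suc\<close> keeps the
    parameter of \<open>exp_shift\<close> positive.\<close>
  define L where "L n l = (\<Sum>\<epsilon>\<in>signs. F \<epsilon> (exp_shift (real (Suc n)) \<epsilon> l))" for n l
  have "\<exists>N :: ((real^'n) \<times> 'n list) measure.
      has_exp_moments N (\<lambda>(\<epsilon>, js). grid_point (real (Suc n)) \<epsilon> js) (L n)" for n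
    using discrete_exp_moments[of F "real (Suc n)", OF F one] unfolding L_def by simp
  then obtain N :: "nat \<Rightarrow> ((real^'n) \<times> 'n list) measure"
    where N: "\<And>n. has_exp_moments (N n) (\<lambda>(\<epsilon>, js). grid_point (real (Suc n)) \<epsilon> js) (L n)"
    by metis
  have "(\<lambda>n. L n l) \<longlonglongrightarrow> exp (\<phi> l)" for l
    unfolding L_def sum_F
  proof (rule tendsto_sum)
    fix \<epsilon> :: "real^'n" assume \<epsilon>: "\<epsilon> \<in> signs"
    then have "smooth (F \<epsilon>)"
      using F by (simp add: octant_monotonic_def)
    then show "(\<lambda>n. F \<epsilon> (exp_shift (real (Suc n)) \<epsilon> l)) \<longlonglongrightarrow> F \<epsilon> l"
      by (intro isCont_tendsto_compose[OF smooth_isCont] exp_shift_tendsto \<epsilon>)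
  qed
  from exp_moments_limit[OF N this] obtain M :: "real measure" and \<xi>
    where "has_exp_moments M \<xi> (\<lambda>l. exp (\<phi> l))"
    by blast
  \<comment> \<open>The limit vector lives on the real line as sample space; its law moves it to
    \<open>real^'n\<close>.\<close>
  from has_exp_moments_canonical[OF this]
  show "\<exists>(M :: (real^'n) measure) (\<xi> :: real^'n \<Rightarrow> real^'n). has_exp_moments M \<xi> (\<lambda>l. exp (\<phi> l))"
    by blast
qed

end
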